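(* Let $\Phi:\mathbb{R}^2\to\mathbb{R}$, $h:\mathbb{R}^n\to\mathbb{R}^2$, $N:\mathbb{R}^n\to\mathbb{R}^{n-2}$ satisfy Assumptions 1 and 2 listed in the context. Consider the mechanical system written in the coordinates $\mathbf{x}=\mathrm{col}(\mathbf{q},p)$, $\mathbf{q}=\mathrm{col}(\mathbf{q}_y,\mathbf{q}_N)=T(q)$, $$\dot{\mathbf{x}}=\begin{bmatrix} 0 & \mathcal{A}(\mathbf{q}) \\ -\mathcal{A}^\top(\mathbf{q}) & -\mathbf{R}(\mathbf{x}) \end{bmatrix}\nabla\mathcal{H}(\mathbf{x})+\begin{bmatrix} 0 \\ \mathbf{G}(\mathbf{q}) \end{bmatrix}u,$$ and the target system $\dot\xi=F(\xi,x)\nabla V_d(\xi)$, $\xi\in\mathbb{R}^2$ (all objects as defined in the context). Then there exist mappings $$\pi:\mathbb{R}^2\times\mathbb{R}^{2n}\to\mathbb{R}^{2n},\qquad \phi:\mathbb{R}^{2n}\to\mathbb{R}^{2},\qquad c:\mathbb{R}^2\times\mathbb{R}^{2n}\to\mathbb{R}^m,$$ with $\operatorname{rank}\{\nabla_\xi\pi(\xi,\mathbf{x})\}=2$, such that the mechanical system in closed loop with $u=c(\xi,\mathbf{x})$ (together with the target system) satisfies: (A2') (immersion condition) the manifold $\mathcal{M}_e:=\{(\mathbf{x},\xi)\in\mathbb{R}^{2n}\times\mathbb{R}^2 \mid \mathbf{x}=\pi(\xi,\mathbf{x})\}$ is invariant; equivalently, $\dot{\mathbf{x}}|_{\mathbf{x}=\pi(\xi,\mathbf{x})}=\frac{d}{dt}[\pi(\xi,\mathbf{x})]$.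 (A3') (implicit manifold condition) $\phi(x)=0$ if and only if $\mathbf{x}=\pi(\xi,\mathbf{x})$ (for some $\xi\in\mathbb{R}^2$), where $x=\mathrm{col}(q,p)$ and $\mathbf{x}=\mathrm{col}(T(q),p)$ represent the same state. Furthermore, the controller $u=c(\xi,\mathbf{x})$ guarantees that the manifold $\mathcal{M}:=\{(q,p,\xi)\in\mathbb{R}^n\times\mathbb{R}^n\times\mathbb{R}^2\mid h(q)=\xi\}$ is invariant.
   Context: All mappings are assumed sufficiently smooth. $\nabla f:=(\partial f/\partial x)^\top$, so for a vector-valued map $h$, $\nabla h^\top$ is its Jacobian. **Mechanical system.** With $x=\mathrm{col}(q,p)$, $q,p\in\mathbb{R}^n$, input $u\in\mathbb{R}^m$, $2\le m<n$, $$\dot x=\begin{bmatrix} 0_{n\times n} & A(q) \\ -A^\top(q) & -R(x) \end{bmatrix}\nabla H(x)+\begin{bmatrix} 0_{n\times m} \\ G(q) \end{bmatrix}u,\qquad H(q,p)=\tfrac12p^\top M^{-1}(q)p+U(q),$$ where $R(x)+R^\top(x)\ge0$, $G(q)\in\mathbb{R}^{n\times m}$ and $A(q)\in\mathbb{R}^{n\times n}$ are full rank, $M(q)$ is symmetric positive definite, and $U:\mathbb{R}^n\to\mathbb{R}$. The regulated output is $\mathbf{q}_y=h(q)\in\mathbb{R}^2$, with $\operatorname{rank}\nabla h(q)=2$. **Assumption 1.** The path $\mathcal{C}=\{\mathbf{q}_y\in\mathbb{R}^2\mid\Phi(\mathbf{q}_y)=0\}$ is a smooth Jordan curve (diffeomorphic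 to the unit circle) given by a smooth regular function $\Phi$: $\nabla\Phi\ne0$ on an open set containing $\mathcal{C}$, and boundedness of $\Phi(\xi(\cdot))$ implies boundedness of $\xi(\cdot)$. The set $\Omega:=\{\xi\in\mathbb{R}^2\mid\nabla\Phi(\xi)=0\}$ consists of only finitely many isolated points, and $\Phi(a)\Phi(b)>0$ for all $a,b\in\Omega$. **Assumption 2.** (i) The matrix $\nabla h^\top(q)A(q)M^{-1}(q)G(q)\in\mathbb{R}^{2\times m}$ is full rank. (ii) There is a map $N:\mathbb{R}^n\to\mathbb{R}^{n-2}$ such that $T(q)=\begin{bmatrix} h(q) \\ N(q) \end{bmatrix}=:\mathbf{q}=\begin{bmatrix} \mathbf{q}_y \\ \mathbf{q}_N \end{bmatrix}$ is injective; $T$ is used as a change of coordinates, i.e. a diffeomorphism (onto its image) with inverse $T^{\mathtt{I}}$. **Transformed system.** $\mathcal{H}(\mathbf{q},p):=\frac12p^\top M^{-1}(T^{\mathtt{I}}(\mathbf{q}))p+U(T^{\mathtt{I}}(\mathbf{q}))$, $\mathcal{A}(\mathbf{q}):=\nabla T^\top(T^{\mathtt{I}}(\mathbf{q}))A(T^{\mathtt{I}}(\mathbf{q}))$, $\mathbf{R}(\mathbf{q},p):=R(T^{\mathtt{I}}(\mathbf{q}),p)$, $\mathbf{G}(\mathbf{q}):=G(T^{\mathtt{I}}(\mathbf{q}))$. **Target system.** $\dot\xi=F(\xi,x)\nabla V_d(\xi)$ with $V_d(\xi)=\frac12|\Phi(\xi)|^2$, $F(\xi,x)=\mathcal{J}(\xi,x)-\mathcal{R}(\xi)$,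 $\mathcal{J}(\xi,x)=\frac{w(\xi,x)}{\Phi(\xi)}\begin{bmatrix} 0 & 1 \\ -1 & 0 \end{bmatrix}$, $\mathcal{R}(\xi)\in\mathbb{R}^{2\times2}$ positive definite, and $w:\mathbb{R}^2\times\mathbb{R}^{2n}\to\mathbb{R}$ a free mapping. Since $\nabla V_d=\Phi\nabla\Phi$, the right-hand side is understood as $w(\xi,x)\begin{bmatrix} 0 & 1 \\ -1 & 0 \end{bmatrix}\nabla\Phi(\xi)-\Phi(\xi)\mathcal{R}(\xi)\nabla\Phi(\xi)$, which is well defined everywhere.
   Formalization: Invariance of 𝓜 is false as stated: u cannot affect d/dt(h(q)−ξ). Proved instead: 𝓜∩{φ=0} is invariant, and φ=0 is exactly where this velocity vanishes on 𝓜 if the matrix of u in its derivative has rank 2 (automatic for w independent of p; otherwise φ may have no zeros). *)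

theory Defs
  imports "HOL-Analysis.Analysis"
begin

section \<open>Calculus\<close>

text \<open>
  In finite dimension, continuity of all iterated directional derivatives of order at most \<open>k\<close>
  is the usual class \<open>C\<^sup>k\<close>.
\<close>

fun Ck_on :: "nat \<Rightarrow> 'a::euclidean_space set \<Rightarrow> ('a \<Rightarrow> 'b::real_normed_vector) \<Rightarrow> bool" where
  "Ck_on 0 S f \<longleftrightarrow> continuous_on S f"
| "Ck_on (Suc k) S f \<longleftrightarrow>
     (\<forall>x\<in>S. f differentiable (at x)) \<and>
     (\<forall>v. Ck_on k S (\<lambda>x. frechet_derivative f (at x) v))"

definition smooth_on :: "'a::euclidean_space set \<Rightarrow> ('a \<Rightarrow> 'b::real_normed_vector) \<Rightarrow> bool" where
  "smooth_on S f \<longleftrightarrow> open S \<and> (\<forall>k. Ck_on k S f)"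

definition grad :: "(real^'n \<Rightarrow> real) \<Rightarrow> real^'n \<Rightarrow> real^'n" where
  "grad f x = (\<chi> i. frechet_derivative f (at x) (axis i 1))"

definition diffeomorphism_onto_image :: "('a::euclidean_space \<Rightarrow> 'b::euclidean_space) \<Rightarrow> bool" where
  "diffeomorphism_onto_image T \<longleftrightarrow>
     inj T \<and> smooth_on UNIV T \<and> smooth_on (range T) (inv T)"

text \<open>Smoothness of a map on a curve means, as usual, existence of a smooth extension to an open
  neighbourhood.\<close>

definition smooth_Jordan_curve :: "(real^2) set \<Rightarrow> bool" where
  "smooth_Jordan_curve C \<longleftrightarrow>
     (\<exists>f g V W. homeomorphism (sphere (0 :: real^2) 1) C f g \<and>
        sphere 0 1 \<subseteq> V \<and> smooth_on V f \<and> C \<subseteq> W \<and> smooth_on W g)"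

definition pos_def :: "real^'n^'n \<Rightarrow> bool" where
  "pos_def B \<longleftrightarrow> (\<forall>v. v \<noteq> 0 \<longrightarrow> 0 < v \<bullet> (B *v v))"

definition pos_semidef :: "real^'n^'n \<Rightarrow> bool" where
  "pos_semidef B \<longleftrightarrow> (\<forall>v. 0 \<le> v \<bullet> (B *v v))"

definition col :: "'a^'m \<Rightarrow> 'a^'n \<Rightarrow> 'a^('m + 'n)" where
  "col u v = (\<chi> i. case i of Inl a \<Rightarrow> u $ a | Inr b \<Rightarrow> v $ b)"


section \<open>The desired path\<close>

definition admissible_path :: "(real^2 \<Rightarrow> real) \<Rightarrow> bool" where
  "admissible_path \<Phi> \<longleftrightarrow>
     smooth_on UNIV \<Phi> \<and>
     smooth_Jordan_curve {y. \<Phi> y = 0} \<and>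
     (\<exists>V. open V \<and> {y. \<Phi> y = 0} \<subseteq> V \<and> (\<forall>y\<in>V. grad \<Phi> y \<noteq> 0)) \<and>
     (\<forall>\<xi> :: real \<Rightarrow> real^2. continuous_on {0..} \<xi> \<longrightarrow>
        bounded ((\<lambda>t. \<Phi> (\<xi> t)) ` {0..}) \<longrightarrow> bounded (\<xi> ` {0..})) \<and>
     finite {y. grad \<Phi> y = 0} \<and>
     (\<forall>a b. grad \<Phi> a = 0 \<longrightarrow> grad \<Phi> b = 0 \<longrightarrow> \<Phi> a * \<Phi> b > 0)"


section \<open>Mechanical systems\<close>

text \<open>The configuration and momentum index types may differ, so that the definition covers the
  original as well as the transformed coordinates.\<close>

definition mech_field ::
  "(real^'a \<Rightarrow> real^'b^'a) \<Rightarrow> ((real^'a) \<times> (real^'b) \<Rightarrow> real^'b^'b) \<Rightarrow> (real^'a \<Rightarrow> real^'m^'b) \<Rightarrow>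
   ((real^'a) \<times> (real^'b) \<Rightarrow> real) \<Rightarrow> (real^'a) \<times> (real^'b) \<Rightarrow> real^'m \<Rightarrow> (real^'a) \<times> (real^'b)" where
  "mech_field A R G H = (\<lambda>(q, p) u.
     (A q *v grad (\<lambda>p'. H (q, p')) p,
      - (transpose (A q) *v grad (\<lambda>q'. H (q', p)) q)
        - R (q, p) *v grad (\<lambda>p'. H (q, p')) p + G q *v u))"

definition hamiltonian ::
  "(real^'n \<Rightarrow> real^'n^'n) \<Rightarrow> (real^'n \<Rightarrow> real) \<Rightarrow> (real^'n) \<times> (real^'n) \<Rightarrow> real" where
  "hamiltonian M U = (\<lambda>(q, p). 1/2 * (p \<bullet> (matrix_inv (M q) *v p)) + U q)"

definition to_new :: "('q \<Rightarrow> 'r) \<Rightarrow> 'q \<times> 'p \<Rightarrow> 'r \<times> 'p" where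
  "to_new T = (\<lambda>(q, p). (T q, p))"

definition to_old :: "('q \<Rightarrow> 'r) \<Rightarrow> 'r \<times> 'p \<Rightarrow> 'q \<times> 'p" where
  "to_old T = (\<lambda>(y, p). (inv T y, p))"

text \<open>The physical states in the new coordinates: off \<open>range T\<close> the inverse of \<open>T\<close>, hence the
  transformed system, is not defined.\<close>

definition new_states :: "('q \<Rightarrow> 'r) \<Rightarrow> ('r \<times> 'p) set" where
  "new_states T = range T \<times> UNIV"

definition new_mech_field ::
  "(real^'n \<Rightarrow> real^'r) \<Rightarrow> (real^'n \<Rightarrow> real^'n^'n) \<Rightarrow> ((real^'n) \<times> (real^'n) \<Rightarrow> real^'n^'n) \<Rightarrow>
   (real^'n \<Rightarrow> real^'m^'n) \<Rightarrow> ((real^'n) \<times> (real^'n) \<Rightarrow> real) \<Rightarrow>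
   (real^'r) \<times> (real^'n) \<Rightarrow> real^'m \<Rightarrow> (real^'r) \<times> (real^'n)" where
  "new_mech_field T A R G H =
     mech_field (\<lambda>y. jacobian T (at (inv T y)) ** A (inv T y)) (\<lambda>x. R (to_old T x))
       (\<lambda>y. G (inv T y)) (\<lambda>x. H (to_old T x))"


section \<open>The target system\<close>

definition J2 :: "real^2^2" where
  "J2 = vector [vector [0, 1], vector [-1, 0]]"

definition target ::
  "(real^2 \<Rightarrow> real) \<Rightarrow> (real^2 \<Rightarrow> 'x \<Rightarrow> real) \<Rightarrow> (real^2 \<Rightarrow> real^2^2) \<Rightarrow>
   real^2 \<Rightarrow> 'x \<Rightarrow> real^2" where
  "target \<Phi> w RR \<xi> x = w \<xi> x *\<^sub>R (J2 *v grad \<Phi> \<xi>) - \<Phi> \<xi> *\<^sub>R (RR \<xi> *v grad \<Phi> \<xi>)"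

text \<open>Off the curve this is \<open>F \<nabla>V\<^sub>d\<close> with \<open>F = (w / \<Phi>) J2 - RR\<close> and \<open>V\<^sub>d = |\<Phi>|\<^sup>2 / 2\<close>.\<close>

lemma grad_Vd:
  assumes "\<Phi> differentiable (at \<xi>)"
  shows "grad (\<lambda>y. 1/2 * \<bar>\<Phi> y\<bar>\<^sup>2) \<xi> = \<Phi> \<xi> *\<^sub>R grad \<Phi> \<xi>"
proof -
  have "(\<Phi> has_derivative frechet_derivative \<Phi> (at \<xi>)) (at \<xi>)"
    using assms frechet_derivative_works by blast
  then have "((\<lambda>y. 1/2 * \<bar>\<Phi> y\<bar>\<^sup>2) has_derivative (\<lambda>v. \<Phi> \<xi> * frechet_derivative \<Phi> (at \<xi>) v)) (at \<xi>)"
    unfolding power2_abs by (auto intro!: derivative_eq_intros)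
  then have "frechet_derivative (\<lambda>y. 1/2 * \<bar>\<Phi> y\<bar>\<^sup>2) (at \<xi>) =
      (\<lambda>v. \<Phi> \<xi> * frechet_derivative \<Phi> (at \<xi>) v)"
    by (rule frechet_derivative_at[symmetric])
  then show ?thesis
    by (simp add: grad_def vec_eq_iff)
qed

lemma target_eq:
  assumes "\<Phi> differentiable (at \<xi>)" and "\<Phi> \<xi> \<noteq> 0"
  shows "target \<Phi> w RR \<xi> x =
    ((w \<xi> x / \<Phi> \<xi>) *\<^sub>R J2 - RR \<xi>) *v grad (\<lambda>y. 1/2 * \<bar>\<Phi> y\<bar>\<^sup>2) \<xi>"
  unfolding grad_Vd[OF assms(1)] target_def
  using assms(2)
  by (simp add: matrix_vector_mult_diff_rdistrib scaleR_matrix_vector_assoc[symmetric]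
      matrix_vector_mult_scaleR scaleR_right_diff_distrib)


section \<open>Closed loop and invariance\<close>

definition closed_loop ::
  "('x \<Rightarrow> 'u \<Rightarrow> 'x) \<Rightarrow> ('z \<Rightarrow> 'x \<Rightarrow> 'z) \<Rightarrow> ('z \<Rightarrow> 'x \<Rightarrow> 'u) \<Rightarrow> 'x \<times> 'z \<Rightarrow> 'x \<times> 'z" where
  "closed_loop X s c = (\<lambda>(x, \<xi>). (X x (c \<xi> x), s \<xi> x))"

definition solution_on ::
  "'s::real_normed_vector set \<Rightarrow> ('s \<Rightarrow> 's) \<Rightarrow> real set \<Rightarrow> (real \<Rightarrow> 's) \<Rightarrow> bool" where
  "solution_on D X I z \<longleftrightarrow>
     (\<forall>t\<in>I. z t \<in> D \<and> (z has_vector_derivative X (z t)) (at t within I))"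

definition invariant_set ::
  "'s::real_normed_vector set \<Rightarrow> ('s \<Rightarrow> 's) \<Rightarrow> 's set \<Rightarrow> bool" where
  "invariant_set D X S \<longleftrightarrow>
     (\<forall>I z. is_interval I \<and> solution_on D X I z \<and> (\<exists>t\<in>I. z t \<in> S) \<longrightarrow> (\<forall>t\<in>I. z t \<in> S))"

definition immersed_manifold :: "('x set) \<Rightarrow> ('z \<Rightarrow> 'x \<Rightarrow> 'x) \<Rightarrow> ('x \<times> 'z) set" where
  "immersed_manifold D \<pi> = {(x, \<xi>). x \<in> D \<and> x = \<pi> \<xi> x}"

text \<open>The infinitesimal form of the immersion condition: on the manifold, the state velocity equals
  the derivative of \<open>\<pi> \<xi> x\<close> along the closed-loop field \<open>Z\<close>.\<close>

definition immersion_equation ::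
  "'x::real_normed_vector set \<Rightarrow> ('x \<times> 'z::real_normed_vector \<Rightarrow> 'x \<times> 'z) \<Rightarrow>
   ('z \<Rightarrow> 'x \<Rightarrow> 'x) \<Rightarrow> bool" where
  "immersion_equation D Z \<pi> \<longleftrightarrow>
     (\<forall>(x, \<xi>) \<in> immersed_manifold D \<pi>.
        fst (Z (x, \<xi>)) = frechet_derivative (\<lambda>(x, \<xi>). \<pi> \<xi> x) (at (x, \<xi>)) (Z (x, \<xi>)))"

text \<open>The normal velocity of the closed loop on \<open>{h q = \<xi>}\<close>: time derivative of \<open>h q - \<xi>\<close> at
  \<open>\<xi> = h q\<close>. It does not involve the input, so \<open>{h q = \<xi>}\<close> can be kept invariant only on the part where
  this vanishes; the input enters its derivative through the \<open>p\<close>-Jacobian times \<open>G q\<close>, which is the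
  matrix \<open>\<nabla>h\<^sup>T A M\<^sup>-\<^sup>1 G\<close> whenever the target does not depend on \<open>p\<close>.\<close>

definition velocity_mismatch ::
  "(real^'n \<Rightarrow> real^2) \<Rightarrow> (real^'n \<Rightarrow> real^'n^'n) \<Rightarrow> (real^'n \<Rightarrow> real^'n^'n) \<Rightarrow>
   (real^2 \<Rightarrow> (real^'n) \<times> (real^'n) \<Rightarrow> real^2) \<Rightarrow> real^'n \<Rightarrow> real^'n \<Rightarrow> real^2" where
  "velocity_mismatch h A M s q p =
     (jacobian h (at q) ** A q ** matrix_inv (M q)) *v p - s (h q) (q, p)"

end

theory Submission
  imports Defs
begin

text \<open>The output velocity \<open>\<nabla>h\<^sup>T A M\<^sup>-\<^sup>1 p\<close> does not involve the input, so \<open>{h q = \<xi>}\<close> can be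
  followed only where the velocity mismatch \<open>\<phi>(q, p) = \<nabla>h\<^sup>T A M\<^sup>-\<^sup>1 p - s (h q) (q, p)\<close> vanishes. Its
  derivative along the system is affine in the input with matrix \<open>W = \<partial>\<phi>/\<partial>p G\<close>; where \<open>W\<close> has full
  row rank, the feedback built from the right inverse \<open>W\<^sup>T (W W\<^sup>T)\<^sup>-\<^sup>1\<close> makes \<open>\<phi>\<close> a first integral of
  the closed loop. On \<open>{\<phi> = 0}\<close> both \<open>h q\<close> and \<open>\<xi>\<close> then follow the field \<open>s\<close>, which is locally
  Lipschitz in \<open>\<xi>\<close>, and by Gronwall's inequality they agree throughout if they agree once. If \<open>W\<close>
  loses rank somewhere, the zero set of \<open>\<phi>\<close> is unconstrained by the claim and may be taken empty.\<close>

section \<open>Calculus of smooth maps\<close>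

text \<open>Derivatives at a point see only a neighbourhood, and openness of \<open>S\<close>
  provides one on which the maps agree. The directional derivatives therefore agree on
  \<open>S\<close> as well, and the induction continues with them.\<close>

lemma Ck_on_cong:
  assumes "open S" "\<And>x. x \<in> S \<Longrightarrow> f x = g x"
  shows "Ck_on k S f \<longleftrightarrow> Ck_on k S g"
proof -
  have imp: "Ck_on k S g" if "Ck_on k S f" "\<And>x. x \<in> S \<Longrightarrow> f x = g x" for f g
    using that
  proof (induction k arbitrary: f g)
    case 0
    then show ?case by (metis Ck_on.simps(1) continuous_on_cong)
  next
    case (Suc k)
    have d: "f differentiable at x" if "x \<in> S" for x
      using Suc.prems that by simp
    have "g differentiable at x" if "x \<in> S" for x
      using has_derivative_transform_within_open[of f _ x UNIV S g] d[OF that] assms(1) that Suc.prems(2)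
      unfolding differentiable_def by blast
    moreover have "Ck_on k S (\<lambda>x. frechet_derivative g (at x) v)" for v
    proof (rule Suc.IH)
      show "Ck_on k S (\<lambda>x. frechet_derivative f (at x) v)"
        using Suc.prems(1) by simp
      show "frechet_derivative f (at x) v = frechet_derivative g (at x) v" if "x \<in> S" for x
        using frechet_derivative_transform_within_open[of f x S g] d[OF that] assms(1) that Suc.prems(2)
        by simp
    qed
    ultimately show ?case by simp
  qed
  show ?thesis using imp[of f g] imp[of g f] assms(2) by auto
qed

text \<open>Replaces the choice operator in \<open>frechet_derivative\<close> by an explicit formula
  \<open>f'\<close>. The closure proofs below are inductions on \<open>k\<close> through this rule:
  differentiate once, then recognise the derivative as built from maps of class
  \<open>k\<close>.\<close>

lemma Ck_on_SucI:
  assumes "open S" "\<And>x. x \<in> S \<Longrightarrow> (f has_derivative f' x) (at x)"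
    and "\<And>v. Ck_on k S (\<lambda>x. f' x v)"
  shows "Ck_on (Suc k) S f"
proof -
  have "Ck_on k S (\<lambda>x. frechet_derivative f (at x) v)" for v
    using assms(3)[of v] frechet_derivative_at[OF assms(2)]
    by (subst Ck_on_cong[OF assms(1), of _ "\<lambda>x. f' x v"]) auto
  then show ?thesis
    using assms(2) by (auto simp: differentiable_def)
qed

lemma Ck_on_Suc_has_derivative:
  assumes "Ck_on (Suc k) S f" "x \<in> S"
  shows "(f has_derivative frechet_derivative f (at x)) (at x)"
  using assms frechet_derivative_works by auto

lemma Ck_on_Suc_frechet: "Ck_on (Suc k) S f \<Longrightarrow> Ck_on k S (\<lambda>x. frechet_derivative f (at x) v)"
  by simp

lemma Ck_on_Suc_imp: "Ck_on (Suc k) S f \<Longrightarrow> Ck_on k S f"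
proof (induction k arbitrary: f)
  case 0
  then show ?case
    by (auto intro!: continuous_at_imp_continuous_on differentiable_imp_continuous_within)
next
  case (Suc k)
  then show ?case by (metis Ck_on.simps(2))
qed

lemma Ck_on_const:
  assumes "open S"
  shows "Ck_on k S (\<lambda>x. c)"
proof (induction k arbitrary: c)
  case (Suc k)
  show ?case
    by (rule Ck_on_SucI[where f' = "\<lambda>x v. 0", OF assms has_derivative_const Suc.IH])
qed simp

lemma Ck_on_bounded_linear:
  assumes "bounded_linear L" "open S" "Ck_on k S f"
  shows "Ck_on k S (\<lambda>x. L (f x))"
  using assms(3)
proof (induction k arbitrary: f)
  case 0
  then show ?case using assms(1) by (simp add: bounded_linear.continuous_on)
next
  case (Suc k)
  show ?case
    by (rule Ck_on_SucI[OF assms(2) bounded_linear.has_derivative[OF assms(1)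
            Ck_on_Suc_has_derivative[OF Suc.prems]] Suc.IH[OF Ck_on_Suc_frechet[OF Suc.prems]]])
qed

lemma Ck_on_ident:
  assumes "open S"
  shows "Ck_on k S (\<lambda>x. x)"
proof (cases k)
  case (Suc m)
  show ?thesis
    unfolding Suc by (rule Ck_on_SucI[OF assms has_derivative_ident Ck_on_const[OF assms]])
qed simp

lemma Ck_on_add:
  assumes "open S" "Ck_on k S f" "Ck_on k S g"
  shows "Ck_on k S (\<lambda>x. f x + g x)"
  using assms(2,3)
proof (induction k arbitrary: f g)
  case 0
  then show ?case by (auto intro: continuous_on_add)
next
  case (Suc k)
  show ?case
    by (rule Ck_on_SucI[OF assms(1) has_derivative_add[OF Suc.prems[THEN Ck_on_Suc_has_derivative]]
          Suc.IH[OF Suc.prems[THEN Ck_on_Suc_frechet]]])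
qed

lemma Ck_on_sum:
  assumes "open S" "\<And>i. i \<in> I \<Longrightarrow> Ck_on k S (f i)"
  shows "Ck_on k S (\<lambda>x. \<Sum>i\<in>I. f i x)"
  using assms(2)
  by (induction I rule: infinite_finite_induct) (auto intro!: Ck_on_add Ck_on_const assms(1))

text \<open>Leibniz rule: each summand of the derivative differentiates one factor only, and the
  other factor drops to order \<open>k\<close> by \<open>Ck_on_Suc_imp\<close>. Scalar multiples,
  inner products and matrix products are all instances.\<close>

lemma Ck_on_bilinear:
  assumes "bounded_bilinear B" "open S" "Ck_on k S f" "Ck_on k S g"
  shows "Ck_on k S (\<lambda>x. B (f x) (g x))"
  using assms(3,4)
proof (induction k arbitrary: f g)
  case 0
  then show ?case using assms(1) by (simp add: bounded_bilinear.continuous_on)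
next
  case (Suc k)
  show ?case
    by (rule Ck_on_SucI[OF assms(2) bounded_bilinear.FDERIV[OF assms(1)
            Suc.prems[THEN Ck_on_Suc_has_derivative]]
          Ck_on_add[OF assms(2)
            Suc.IH[OF Suc.prems(1)[THEN Ck_on_Suc_imp] Suc.prems(2)[THEN Ck_on_Suc_frechet]]
            Suc.IH[OF Suc.prems(1)[THEN Ck_on_Suc_frechet] Suc.prems(2)[THEN Ck_on_Suc_imp]]]])
qed

lemma linear_euclidean_expansion:
  fixes L :: "'a::euclidean_space \<Rightarrow> 'b::real_vector"
  assumes "linear L"
  shows "L v = (\<Sum>b\<in>Basis. (v \<bullet> b) *\<^sub>R L b)"
proof -
  have "L v = L (\<Sum>b\<in>Basis. (v \<bullet> b) *\<^sub>R b)"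
    by (simp add: euclidean_representation)
  then show ?thesis
    using assms by (simp add: linear_sum linear_cmul)
qed

lemma Ck_on_compose:
  fixes f :: "'a::euclidean_space \<Rightarrow> 'b::euclidean_space" and g :: "'b \<Rightarrow> 'c::real_normed_vector"
  assumes "open S" "open V" "f ` S \<subseteq> V" "Ck_on k S f" "Ck_on k V g"
  shows "Ck_on k S (\<lambda>x. g (f x))"
  using assms(4,5)
proof (induction k arbitrary: g)
  case 0
  then show ?case using assms(3) by (auto intro: continuous_on_compose2)
next
  case (Suc k)
  \<comment> \<open>In the chain rule the direction in which \<open>g\<close> is differentiated
    moves with \<open>x\<close>, whereas \<open>Ck_on\<close> speaks of fixed directions. Expanding
    it in the basis leaves fixed directions with varying coefficients.\<close>
  let ?f' = "\<lambda>x v. \<Sum>b\<in>Basis. (frechet_derivative f (at x) v \<bullet> b) *\<^sub>R frechet_derivative g (at (f x)) b"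
  have der: "((\<lambda>x. g (f x)) has_derivative ?f' x) (at x)" if "x \<in> S" for x
  proof -
    have g: "(g has_derivative frechet_derivative g (at (f x))) (at (f x))"
      using Suc.prems(2) that assms(3) by (intro Ck_on_Suc_has_derivative) auto
    have "((\<lambda>x. g (f x)) has_derivative (\<lambda>v. frechet_derivative g (at (f x)) (frechet_derivative f (at x) v))) (at x)"
      using has_derivative_compose[OF Ck_on_Suc_has_derivative[OF Suc.prems(1) that] g] by simp
    also have "(\<lambda>v. frechet_derivative g (at (f x)) (frechet_derivative f (at x) v)) = ?f' x"
      by (rule ext, rule linear_euclidean_expansion[OF has_derivative_linear[OF g]])
    finally show ?thesis .
  qed
  show ?case
  proof (rule Ck_on_SucI[OF assms(1) der])
    fix v
    have f': "Ck_on k S (\<lambda>x. frechet_derivative f (at x) v)"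
      by (rule Ck_on_Suc_frechet[OF Suc.prems(1)])
    show "Ck_on k S (\<lambda>x. ?f' x v)"
      by (rule Ck_on_sum[OF assms(1)], rule Ck_on_bilinear[OF bounded_bilinear_scaleR assms(1)
            Ck_on_bounded_linear[OF bounded_linear_inner_left assms(1) f']
            Suc.IH[OF Ck_on_Suc_imp[OF Suc.prems(1)] Ck_on_Suc_frechet[OF Suc.prems(2)]]])
  qed
qed

text \<open>The induction closes because the derivative of \<open>inverse\<close> is a polynomial in
  \<open>inverse\<close> itself.\<close>

lemma Ck_on_inverse: "Ck_on k (- {0 :: real}) inverse"
proof (induction k)
  case 0
  show ?case by (auto intro!: continuous_on_inverse)
next
  case (Suc k)
  have S: "open (- {0 :: real})" by auto
  show ?case
  proof (rule Ck_on_SucI[OF S])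
    show "(inverse has_derivative (\<lambda>v. - (inverse x * v * inverse x))) (at x)" if "x \<in> - {0}" for x :: real
      using that by (auto intro: has_derivative_inverse')
    show "Ck_on k (- {0}) (\<lambda>x :: real. - (inverse x * v * inverse x))" for v
      by (rule Ck_on_bounded_linear[OF bounded_linear_minus[OF bounded_linear_ident] S
            Ck_on_bilinear[OF bounded_bilinear_mult S
              Ck_on_bilinear[OF bounded_bilinear_mult S Suc Ck_on_const[OF S]] Suc]])
  qed
qed

section \<open>Closure properties of smooth maps\<close>

lemma smooth_on_open: "smooth_on S f \<Longrightarrow> open S"
  by (simp add: smooth_on_def)

lemma smooth_on_cong:
  assumes "\<And>x. x \<in> S \<Longrightarrow> f x = g x"
  shows "smooth_on S f \<longleftrightarrow> smooth_on S g"
  unfolding smooth_on_def using Ck_on_cong[of S f g] assms by auto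

lemma smooth_on_has_derivative:
  assumes "smooth_on S f" "x \<in> S"
  shows "(f has_derivative frechet_derivative f (at x)) (at x)"
  using assms Ck_on_Suc_has_derivative unfolding smooth_on_def by blast

lemma smooth_on_frechet_apply: "smooth_on S f \<Longrightarrow> smooth_on S (\<lambda>x. frechet_derivative f (at x) v)"
  unfolding smooth_on_def using Ck_on_Suc_frechet by blast

lemma smooth_on_const: "open S \<Longrightarrow> smooth_on S (\<lambda>x. c)"
  by (simp add: smooth_on_def Ck_on_const)

lemma smooth_on_ident: "open S \<Longrightarrow> smooth_on S (\<lambda>x. x)"
  by (simp add: smooth_on_def Ck_on_ident)

lemma smooth_on_bounded_linear:
  "bounded_linear L \<Longrightarrow> smooth_on S f \<Longrightarrow> smooth_on S (\<lambda>x. L (f x))"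
  by (simp add: smooth_on_def Ck_on_bounded_linear)

lemma smooth_on_linear:
  fixes L :: "'b::euclidean_space \<Rightarrow> 'c::real_normed_vector"
  shows "linear L \<Longrightarrow> smooth_on S f \<Longrightarrow> smooth_on S (\<lambda>x. L (f x))"
  by (rule smooth_on_bounded_linear) (simp_all add: linear_conv_bounded_linear)

lemma smooth_on_add: "smooth_on S f \<Longrightarrow> smooth_on S g \<Longrightarrow> smooth_on S (\<lambda>x. f x + g x)"
  by (simp add: smooth_on_def Ck_on_add)

lemma smooth_on_uminus: "smooth_on S f \<Longrightarrow> smooth_on S (\<lambda>x. - f x)"
  by (rule smooth_on_bounded_linear[OF bounded_linear_minus[OF bounded_linear_ident]])

lemma smooth_on_diff: "smooth_on S f \<Longrightarrow> smooth_on S g \<Longrightarrow> smooth_on S (\<lambda>x. f x - g x)"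
  using smooth_on_add[OF _ smooth_on_uminus, of S f g] by simp

lemma smooth_on_sum:
  "open S \<Longrightarrow> (\<And>i. i \<in> I \<Longrightarrow> smooth_on S (f i)) \<Longrightarrow> smooth_on S (\<lambda>x. \<Sum>i\<in>I. f i x)"
  by (simp add: smooth_on_def Ck_on_sum)

lemma smooth_on_bilinear:
  "bounded_bilinear B \<Longrightarrow> smooth_on S f \<Longrightarrow> smooth_on S g \<Longrightarrow> smooth_on S (\<lambda>x. B (f x) (g x))"
  by (simp add: smooth_on_def Ck_on_bilinear)

lemmas smooth_on_scaleR = smooth_on_bilinear[OF bounded_bilinear_scaleR]
lemmas smooth_on_mult = smooth_on_bilinear[OF bounded_bilinear_mult]
lemmas smooth_on_inner = smooth_on_bilinear[OF bounded_bilinear_inner]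
lemmas smooth_on_fst = smooth_on_bounded_linear[OF bounded_linear_fst]
lemmas smooth_on_snd = smooth_on_bounded_linear[OF bounded_linear_snd]
lemmas smooth_on_nth = smooth_on_bounded_linear[OF bounded_linear_vec_nth]

lemma smooth_on_compose:
  "smooth_on V g \<Longrightarrow> smooth_on S f \<Longrightarrow> f ` S \<subseteq> V \<Longrightarrow> smooth_on S (\<lambda>x. g (f x))"
  for f :: "'a::euclidean_space \<Rightarrow> 'b::euclidean_space"
  unfolding smooth_on_def using Ck_on_compose[of S V f _ g] by blast

lemma smooth_on_compose_UNIV:
  "smooth_on UNIV g \<Longrightarrow> smooth_on S f \<Longrightarrow> smooth_on S (\<lambda>x. g (f x))"
  for f :: "'a::euclidean_space \<Rightarrow> 'b::euclidean_space"
  by (rule smooth_on_compose) auto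

lemma smooth_on_Pair:
  assumes "smooth_on S f" "smooth_on S g"
  shows "smooth_on S (\<lambda>x. (f x, g x))"
proof -
  have "smooth_on S (\<lambda>x. (f x, 0) + (0, g x))"
    using assms by (intro smooth_on_add smooth_on_bounded_linear[where L = "\<lambda>v. (v, 0)"]
        smooth_on_bounded_linear[where L = "\<lambda>v. (0, v)"] bounded_linear_intros)
  then show ?thesis by simp
qed

lemma smooth_on_prod:
  assumes "open S" "\<And>i. i \<in> I \<Longrightarrow> smooth_on S (f i)"
  shows "smooth_on S (\<lambda>x. \<Prod>i\<in>I. f i x :: real)"
  using assms(2)
  by (induction I rule: infinite_finite_induct) (auto intro!: smooth_on_mult smooth_on_const assms(1))

lemma smooth_on_divide:
  assumes "smooth_on S f" "smooth_on S g" "\<And>x. x \<in> S \<Longrightarrow> g x \<noteq> (0 :: real)"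
  shows "smooth_on S (\<lambda>x. f x / g x)"
proof -
  have "smooth_on (- {0 :: real}) inverse"
    using Ck_on_inverse by (auto simp: smooth_on_def)
  then have "smooth_on S (\<lambda>x. inverse (g x))"
    by (rule smooth_on_compose[OF _ assms(2)]) (use assms(3) in auto)
  then have "smooth_on S (\<lambda>x. f x * inverse (g x))"
    by (rule smooth_on_mult[OF assms(1)])
  then show ?thesis by (simp add: divide_inverse)
qed

text \<open>Needed for derivatives along a vector field, where the direction depends on the point;
  the basis expansion reduces this to fixed directions.\<close>

lemma smooth_on_frechet:
  assumes "smooth_on S f" "smooth_on S g"
  shows "smooth_on S (\<lambda>x. frechet_derivative f (at x) (g x))"
proof -
  have eq: "frechet_derivative f (at x) (g x) =
      (\<Sum>b\<in>Basis. (g x \<bullet> b) *\<^sub>R frechet_derivative f (at x) b)" if "x \<in> S" for x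
    by (rule linear_euclidean_expansion[OF has_derivative_linear[OF
            smooth_on_has_derivative[OF assms(1) that]]])
  have "smooth_on S (\<lambda>x. \<Sum>b\<in>Basis. (g x \<bullet> b) *\<^sub>R frechet_derivative f (at x) b)"
    using assms smooth_on_open[OF assms(1)]
    by (intro smooth_on_sum smooth_on_scaleR smooth_on_inner smooth_on_const smooth_on_frechet_apply)
  then show ?thesis
    by (rule smooth_on_cong[THEN iffD1, rotated]) (rule eq[symmetric])
qed

section \<open>Smooth vector- and matrix-valued maps\<close>

lemma smooth_on_vecI:
  fixes f :: "'a::euclidean_space \<Rightarrow> 'b::euclidean_space^'n"
  assumes "\<And>i. smooth_on S (\<lambda>x. f x $ i)"
  shows "smooth_on S f"
proof -
  have lin: "linear (axis i :: 'b \<Rightarrow> 'b^'n)" for i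
    by (rule linearI) (auto simp: axis_def vec_eq_iff)
  have "smooth_on S (\<lambda>x. \<Sum>i\<in>UNIV. axis i (f x $ i))"
    by (rule smooth_on_sum[OF smooth_on_open[OF assms] smooth_on_linear[OF lin assms]])
  moreover have "(\<Sum>i\<in>UNIV. axis i (f x $ i)) = f x" for x
    by (simp add: vec_eq_iff axis_def if_distrib[of "\<lambda>c. c $ _"] sum.delta)
  ultimately show ?thesis by simp
qed

lemma smooth_on_nth2: "smooth_on S f \<Longrightarrow> smooth_on S (\<lambda>x. f x $ i $ j)"
  for f :: "'a::euclidean_space \<Rightarrow> real^'n^'m"
  by (intro smooth_on_nth)

lemma smooth_on_matrix_mult:
  fixes f :: "'a::euclidean_space \<Rightarrow> real^'n^'m" and g :: "'a \<Rightarrow> real^'p^'n"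
  assumes "smooth_on S f" "smooth_on S g"
  shows "smooth_on S (\<lambda>x. f x ** g x)"
  by (rule smooth_on_vecI, rule smooth_on_vecI)
    (auto simp: matrix_matrix_mult_def intro!: smooth_on_sum smooth_on_mult smooth_on_nth assms
      smooth_on_open[OF assms(1)])

lemma smooth_on_matrix_vector_mult:
  fixes f :: "'a::euclidean_space \<Rightarrow> real^'n^'m"
  assumes "smooth_on S f" "smooth_on S g"
  shows "smooth_on S (\<lambda>x. f x *v g x)"
  by (rule smooth_on_vecI)
    (auto simp: matrix_vector_mult_def intro!: smooth_on_sum smooth_on_mult smooth_on_nth assms
      smooth_on_open[OF assms(1)])

lemma smooth_on_transpose:
  fixes f :: "'a::euclidean_space \<Rightarrow> real^'n^'m"
  assumes "smooth_on S f"
  shows "smooth_on S (\<lambda>x. transpose (f x))"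
  by (rule smooth_on_vecI, rule smooth_on_vecI) (auto simp: transpose_def intro!: smooth_on_nth assms)

lemma smooth_on_det:
  fixes f :: "'a::euclidean_space \<Rightarrow> real^'n^'n"
  assumes "smooth_on S f"
  shows "smooth_on S (\<lambda>x. det (f x))"
  unfolding det_def using smooth_on_open[OF assms]
  by (intro smooth_on_sum smooth_on_mult smooth_on_const smooth_on_prod smooth_on_nth assms)

lemma invertible_matrix_inv:
  fixes A :: "'a::semiring_1^'n^'m"
  assumes "invertible A"
  shows "A ** matrix_inv A = mat 1" "matrix_inv A ** A = mat 1"
  using someI_ex[OF assms[unfolded invertible_def]] by (simp_all add: matrix_inv_def)

text \<open>By Cramer's rule every entry of the inverse is a quotient of determinants, whose
  denominator does not vanish on \<open>S\<close>.\<close>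

lemma smooth_on_matrix_inv:
  fixes f :: "'a::euclidean_space \<Rightarrow> real^'n^'n"
  assumes "smooth_on S f" "\<And>x. x \<in> S \<Longrightarrow> invertible (f x)"
  shows "smooth_on S (\<lambda>x. matrix_inv (f x))"
proof (rule smooth_on_vecI, rule smooth_on_vecI)
  fix k l
  \<comment> \<open>\<open>f x\<close> with column \<open>k\<close> replaced by the unit vector
    \<open>axis l 1\<close>: Cramer's numerator for component \<open>k\<close> of the solution
    \<open>y\<close> of \<open>f x *v y = axis l 1\<close>, that is, of column \<open>l\<close> of
    the inverse.\<close>
  let ?C = "\<lambda>x. \<chi> i j. if j = k then axis l 1 $ i else f x $ i $ j"
  have eq: "matrix_inv (f x) $ k $ l = det (?C x) / det (f x)" if "x \<in> S" for x
  proof -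
    have "f x *v (matrix_inv (f x) *v axis l 1) = axis l 1"
      using assms(2)[OF that] by (simp add: matrix_vector_mul_assoc invertible_matrix_inv)
    then have "(matrix_inv (f x) *v axis l 1) $ k = det (?C x) / det (f x)"
      using assms(2)[OF that] by (subst (asm) cramer) (auto simp: invertible_det_nz)
    then show ?thesis by (simp add: matrix_vector_mult_basis column_def)
  qed
  have "smooth_on S ?C"
  proof (rule smooth_on_vecI, rule smooth_on_vecI)
    fix i j show "smooth_on S (\<lambda>x. ?C x $ i $ j)"
      using smooth_on_nth2[OF assms(1), of i j] smooth_on_open[OF assms(1)]
      by (cases "j = k") (simp_all add: smooth_on_const)
  qed
  then have "smooth_on S (\<lambda>x. det (?C x) / det (f x))"
    using assms by (intro smooth_on_divide smooth_on_det) (auto simp: invertible_det_nz)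
  then show "smooth_on S (\<lambda>x. matrix_inv (f x) $ k $ l)"
    using eq by (subst smooth_on_cong) auto
qed

lemma smooth_on_jacobian:
  fixes f :: "real^'n \<Rightarrow> real^'m"
  assumes "smooth_on S f"
  shows "smooth_on S (\<lambda>x. jacobian f (at x))"
  by (rule smooth_on_vecI, rule smooth_on_vecI)
    (auto simp: jacobian_def matrix_def intro!: smooth_on_nth smooth_on_frechet_apply assms)

lemma smooth_on_grad: "smooth_on S f \<Longrightarrow> smooth_on S (grad f)"
  by (rule smooth_on_vecI) (auto simp: grad_def intro!: smooth_on_frechet_apply)

section \<open>Invariant sets\<close>

text \<open>The bound limits the logarithmic growth rate of \<open>e \<bullet> e\<close> to
  \<open>2 * L\<close> in absolute value, so a zero at either end propagates to the other. Both time
  directions are covered because \<open>invariant_set\<close> looks backward as well as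
  forward.\<close>

lemma gronwall_zero_interval:
  fixes e :: "real \<Rightarrow> 'a::real_inner"
  assumes ab: "a \<le> b"
    and der: "\<And>t. t \<in> {a..b} \<Longrightarrow> (e has_vector_derivative e' t) (at t within {a..b})"
    and bound: "\<And>t. t \<in> {a..b} \<Longrightarrow> norm (e' t) \<le> L * norm (e t)"
    and zero: "e a = 0 \<or> e b = 0"
  shows "e a = 0 \<and> e b = 0"
proof -
  have inner_bound: "\<bar>e t \<bullet> e' t\<bar> \<le> L * (e t \<bullet> e t)" if "t \<in> {a..b}" for t
  proof -
    have "\<bar>e t \<bullet> e' t\<bar> \<le> norm (e t) * norm (e' t)"
      by (rule Cauchy_Schwarz_ineq2)
    also have "\<dots> \<le> norm (e t) * (L * norm (e t))"
      using bound[OF that] by (rule mult_left_mono) simp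
    finally show ?thesis by (simp add: dot_square_norm power2_eq_square mult_ac)
  qed
  \<comment> \<open>Weighted squared norm: for \<open>c = - 2 * L\<close> it is nonincreasing and
    for \<open>c = 2 * L\<close> nondecreasing, by \<open>inner_bound\<close>. Since it is
    nonnegative, the first choice carries a zero from \<open>a\<close> to \<open>b\<close>, the
    second from \<open>b\<close> to \<open>a\<close>.\<close>
  let ?g = "\<lambda>c t. exp (c * t) * (e t \<bullet> e t)"
  let ?g' = "\<lambda>c t. exp (c * t) * (c * (e t \<bullet> e t) + 2 * (e t \<bullet> e' t))"
  have g: "(?g c has_derivative (\<lambda>d. d * ?g' c t)) (at t within {a..b})" if "t \<in> {a..b}" for c t
    using der[OF that] unfolding has_vector_derivative_def
    by (auto intro!: derivative_eq_intros simp: fun_eq_iff algebra_simps inner_commute)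
  have mvt: "\<exists>t\<in>{a..b}. ?g c b - ?g c a = (b - a) * ?g' c t" for c
    by (rule mvt_very_simple[OF ab]) (rule g, simp)
  from zero show ?thesis
  proof
    assume "e a = 0"
    obtain t where t: "t \<in> {a..b}" "?g (- 2 * L) b - ?g (- 2 * L) a = (b - a) * ?g' (- 2 * L) t"
      using mvt by blast
    have "?g' (- 2 * L) t \<le> 0"
      using inner_bound[OF t(1)] by (intro mult_nonneg_nonpos) auto
    then have "?g (- 2 * L) b \<le> 0"
      using t(2) ab \<open>e a = 0\<close> by (simp add: mult_nonneg_nonpos)
    then have "e b \<bullet> e b \<le> 0"
      by (simp add: mult_le_0_iff not_le)
    then show ?thesis using \<open>e a = 0\<close> by (metis inner_eq_zero_iff inner_ge_zero order_antisym)
  next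
    assume "e b = 0"
    obtain t where t: "t \<in> {a..b}" "?g (2 * L) b - ?g (2 * L) a = (b - a) * ?g' (2 * L) t"
      using mvt by blast
    have pos: "0 \<le> ?g' (2 * L) t"
      using inner_bound[OF t(1)] by (intro mult_nonneg_nonneg) auto
    have "0 \<le> (b - a) * ?g' (2 * L) t"
      by (rule mult_nonneg_nonneg[OF _ pos]) (use ab in simp)
    then have "?g (2 * L) a \<le> 0"
      using t(2) \<open>e b = 0\<close> by simp
    then have "e a \<bullet> e a \<le> 0"
      by (simp add: mult_le_0_iff not_le)
    then show ?thesis using \<open>e b = 0\<close> by (metis inner_eq_zero_iff inner_ge_zero order_antisym)
  qed
qed

text \<open>The derivative is bounded on the compact ball, and convexity of the ball turns this into
  a Lipschitz bound by the mean value inequality.\<close>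

lemma smooth_on_UNIV_lipschitz_cball:
  fixes f :: "'a::euclidean_space \<Rightarrow> 'b::real_normed_vector"
  assumes "smooth_on UNIV f"
  obtains B where "\<And>x y. x \<in> cball 0 r \<Longrightarrow> y \<in> cball 0 r \<Longrightarrow> norm (f x - f y) \<le> B * norm (x - y)"
proof -
  let ?D = "\<lambda>x. frechet_derivative f (at x)"
  have lin: "linear (?D x)" for x
    by (rule has_derivative_linear[OF smooth_on_has_derivative[OF assms UNIV_I]])
  \<comment> \<open>The sum of the norms of the partial derivatives dominates the operator norm, and
    its continuity follows from that of the directional derivatives alone.\<close>
  have "continuous_on UNIV (\<lambda>x. \<Sum>b\<in>Basis. norm (?D x b))"
    using smooth_on_frechet_apply[OF assms] unfolding smooth_on_def
    by (intro continuous_on_sum continuous_on_norm) (metis Ck_on.simps(1))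
  then have "bounded ((\<lambda>x. \<Sum>b\<in>Basis. norm (?D x b)) ` cball 0 r)"
    by (meson compact_cball compact_continuous_image compact_imp_bounded continuous_on_subset top_greatest)
  then obtain B where "\<forall>x\<in>cball 0 r. norm (\<Sum>b\<in>Basis. norm (?D x b)) \<le> B"
    unfolding bounded_iff ball_simps by blast
  then have B: "(\<Sum>b\<in>Basis. norm (?D x b)) \<le> B" if "x \<in> cball 0 r" for x
    using that norm_ge_zero abs_le_D1 unfolding real_norm_def by blast
  have "onorm (?D x) \<le> B" if "x \<in> cball 0 r" for x
  proof (rule onorm_bound)
    show "0 \<le> B" using B[OF that] by (meson norm_ge_zero order_trans sum_nonneg)
    fix v
    have "norm (?D x v) = norm (\<Sum>b\<in>Basis. (v \<bullet> b) *\<^sub>R ?D x b)"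
      by (subst linear_euclidean_expansion[OF lin]) simp
    also have "\<dots> \<le> (\<Sum>b\<in>Basis. norm v * norm (?D x b))"
      by (intro sum_norm_le) (simp add: mult_right_mono Basis_le_norm)
    also have "\<dots> \<le> B * norm v"
      using mult_left_mono[OF B[OF that] norm_ge_zero, of v]
      by (simp add: sum_distrib_left[symmetric] mult.commute)
    finally show "norm (?D x v) \<le> B * norm v" .
  qed
  then have "norm (f x - f y) \<le> B * norm (x - y)" if "x \<in> cball 0 r" "y \<in> cball 0 r" for x y
    using differentiable_bound[OF convex_cball, of 0 r f ?D B]
      smooth_on_has_derivative[OF assms] that has_derivative_at_withinI by blast
  then show thesis by (rule that)
qed

section \<open>Solutions and transport of invariance\<close>

lemma solution_continuous:
  assumes "solution_on D X I z"
  shows "continuous_on I z"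
  using assms unfolding solution_on_def
  by (meson continuous_on_eq_continuous_within has_vector_derivative_continuous)

lemma solution_compose:
  assumes "solution_on D X I z" "t \<in> I" "(f has_derivative f') (at (z t))"
  shows "((\<lambda>t. f (z t)) has_vector_derivative f' (X (z t))) (at t within I)"
proof -
  have "(z has_derivative (\<lambda>d. d *\<^sub>R X (z t))) (at t within I)"
    using assms(1,2) unfolding solution_on_def has_vector_derivative_def by blast
  from has_derivative_compose[OF this assms(3)] show ?thesis
    using has_derivative_linear[OF assms(3)]
    by (simp add: has_vector_derivative_def linear_cmul)
qed

text \<open>The fields are \<open>\<kappa>\<close>-related, so \<open>\<kappa>\<close> sends
  solutions of \<open>X'\<close> to solutions of \<open>X\<close> on the same interval. This
  transports invariance from the original coordinates to the new ones.\<close>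

lemma invariant_set_pullback:
  assumes inv: "invariant_set D X S"
    and dom: "\<And>y. y \<in> D' \<Longrightarrow> \<kappa> y \<in> D"
    and der: "\<And>y. y \<in> D' \<Longrightarrow> (\<kappa> has_derivative \<kappa>' y) (at y)"
    and conj: "\<And>y. y \<in> D' \<Longrightarrow> \<kappa>' y (X' y) = X (\<kappa> y)"
  shows "invariant_set D' X' {y \<in> D'. \<kappa> y \<in> S}"
  unfolding invariant_set_def
proof (intro allI impI ballI)
  fix I z t
  assume z: "is_interval I \<and> solution_on D' X' I z \<and> (\<exists>t\<in>I. z t \<in> {y \<in> D'. \<kappa> y \<in> S})" and t: "t \<in> I"
  then have sol: "solution_on D' X' I z" by blast
  have zD: "z t \<in> D'" if "t \<in> I" for t
    using z that by (auto simp: solution_on_def)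
  have "solution_on D X I (\<lambda>t. \<kappa> (z t))"
    unfolding solution_on_def
  proof (intro ballI conjI)
    fix t assume "t \<in> I"
    then show "\<kappa> (z t) \<in> D" by (intro dom zD)
    show "((\<lambda>t. \<kappa> (z t)) has_vector_derivative X (\<kappa> (z t))) (at t within I)"
      using solution_compose[OF sol \<open>t \<in> I\<close> der[OF zD[OF \<open>t \<in> I\<close>]]] conj[OF zD[OF \<open>t \<in> I\<close>]]
      by simp
  qed
  then show "z t \<in> {y \<in> D'. \<kappa> y \<in> S}"
    using inv z t zD unfolding invariant_set_def by blast
qed

text \<open>The output error \<open>\<eta> x - \<xi>\<close> vanishes on the whole interval by Gronwall's inequality: along a
  solution in \<open>{\<phi> = 0}\<close>, both \<open>\<eta> x\<close> and \<open>\<xi>\<close> follow the same locally Lipschitz field.\<close>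

lemma invariant_set_output_tracking:
  fixes X :: "'x::euclidean_space \<Rightarrow> 'x" and \<eta> :: "'x \<Rightarrow> 'z::euclidean_space"
    and \<phi> :: "'x \<Rightarrow> 'y::real_normed_vector" and s :: "'z \<Rightarrow> 'x \<Rightarrow> 'z"
  assumes \<eta>: "smooth_on UNIV \<eta>" and \<phi>: "smooth_on UNIV \<phi>" and s: "smooth_on UNIV (\<lambda>(\<xi>, x). s \<xi> x)"
    and \<phi>X: "\<And>x. frechet_derivative \<phi> (at x) (X x) = 0"
    and \<eta>X: "\<And>x. \<phi> x = 0 \<Longrightarrow> frechet_derivative \<eta> (at x) (X x) = s (\<eta> x) x"
  shows "invariant_set UNIV (\<lambda>(x, \<xi>). (X x, s \<xi> x)) {(x, \<xi>). \<eta> x = \<xi> \<and> \<phi> x = 0}"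
  unfolding invariant_set_def
proof (intro allI impI ballI)
  fix I z t1
  let ?S = "{(x, \<xi>). \<eta> x = \<xi> \<and> \<phi> x = 0}"
  assume z: "is_interval I \<and> solution_on UNIV (\<lambda>(x, \<xi>). (X x, s \<xi> x)) I z \<and> (\<exists>t\<in>I. z t \<in> ?S)"
    and t1: "t1 \<in> I"
  note int = z[THEN conjunct1] and sol = z[THEN conjunct2, THEN conjunct1]
  from z[THEN conjunct2, THEN conjunct2] obtain t0 where t0: "t0 \<in> I" "z t0 \<in> ?S" ..
  define x where "x = (\<lambda>t. fst (z t))"
  define \<xi> where "\<xi> = (\<lambda>t. snd (z t))"
  have Zz: "(case z t of (x, \<xi>) \<Rightarrow> (X x, s \<xi> x)) = (X (x t), s (\<xi> t) (x t))" for t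
    by (simp add: x_def \<xi>_def split: prod.split)
  have fst_der: "((\<lambda>y. f (fst y)) has_derivative (\<lambda>v. frechet_derivative f (at (x t)) (fst v))) (at (z t))"
    if "smooth_on UNIV f" for f :: "'x \<Rightarrow> 'c::real_normed_vector" and t
    using has_derivative_compose[OF has_derivative_fst[OF has_derivative_ident], of f _ "z t"]
      smooth_on_has_derivative[OF that, of "x t"] by (simp add: x_def)
  have d\<phi>: "((\<lambda>t. \<phi> (x t)) has_vector_derivative 0) (at t within I)" if "t \<in> I" for t
    using solution_compose[OF sol that fst_der[OF \<phi>]] \<phi>X unfolding Zz by (simp add: x_def)
  have "convex I" using int by (rule is_interval_convex)
  \<comment> \<open>\<open>\<phi>\<close> is a first integral, hence constant on the interval; its
    value at \<open>t0\<close> is zero.\<close>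
  then obtain c where c: "\<And>t. t \<in> I \<Longrightarrow> \<phi> (x t) = c"
    using has_vector_derivative_zero_constant[OF _ d\<phi>] by metis
  have z0: "\<eta> (x t0) = \<xi> t0" "\<phi> (x t0) = 0"
    using t0(2) by (auto simp: x_def \<xi>_def split: prod.splits)
  have \<phi>0: "\<phi> (x t) = 0" if "t \<in> I" for t
    using c[OF that] c[OF t0(1)] z0(2) by simp
  define e where "e = (\<lambda>t. \<eta> (x t) - \<xi> t)"
  \<comment> \<open>Both fields are taken at the same state \<open>x t\<close>, so only the
    \<open>\<xi>\<close>-arguments differ and a Lipschitz bound for \<open>s\<close> controls
    \<open>e'\<close> by \<open>e\<close>.\<close>
  define e' where "e' = (\<lambda>t. s (\<eta> (x t)) (x t) - s (\<xi> t) (x t))"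
  have de: "(e has_vector_derivative e' t) (at t within I)" if "t \<in> I" for t
  proof -
    have "((\<lambda>t. \<eta> (x t)) has_vector_derivative s (\<eta> (x t)) (x t)) (at t within I)"
      using solution_compose[OF sol that fst_der[OF \<eta>]] \<eta>X[OF \<phi>0[OF that]] unfolding Zz
      by (simp add: x_def)
    moreover have "(\<xi> has_vector_derivative s (\<xi> t) (x t)) (at t within I)"
      using solution_compose[OF sol that has_derivative_snd[OF has_derivative_ident]] unfolding Zz
      by (simp add: \<xi>_def)
    ultimately show ?thesis
      unfolding e_def e'_def by (rule has_vector_derivative_diff)
  qed
  \<comment> \<open>The known zero \<open>t0\<close> may lie on either side of \<open>t1\<close>. A
    compact interval between them is used because \<open>I\<close> need not be compact.\<close>
  define a b where "a = min t0 t1" and "b = max t0 t1"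
  have ab: "a \<le> b" "{a..b} \<subseteq> I"
  proof -
    have "a \<in> I" "b \<in> I"
      using t0(1) t1 by (simp_all add: a_def b_def min_def max_def)
    then show "{a..b} \<subseteq> I"
      using mem_is_interval_1_I[OF int] by (meson atLeastAtMost_iff subsetI)
  qed (simp add: a_def b_def)
  have "continuous_on {a..b} (\<lambda>t. (\<xi> t, x t))" "continuous_on {a..b} (\<lambda>t. (\<eta> (x t), x t))"
  proof -
    have zc: "continuous_on {a..b} z"
      using solution_continuous[OF sol] ab(2) continuous_on_subset by blast
    have \<eta>c: "continuous_on UNIV \<eta>"
      using \<eta> unfolding smooth_on_def by (metis Ck_on.simps(1))
    show "continuous_on {a..b} (\<lambda>t. (\<xi> t, x t))"
      unfolding x_def \<xi>_def using zc by (intro continuous_intros)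
    show "continuous_on {a..b} (\<lambda>t. (\<eta> (x t), x t))"
      unfolding x_def using zc by (intro continuous_intros continuous_on_compose2[OF \<eta>c]) auto
  qed
  then have "bounded ((\<lambda>t. (\<xi> t, x t)) ` {a..b} \<union> (\<lambda>t. (\<eta> (x t), x t)) ` {a..b})"
    by (intro bounded_Un[THEN iffD2] conjI compact_imp_bounded compact_continuous_image) auto
  \<comment> \<open>One ball holding the actual pairs \<open>(\<xi> t, x t)\<close> and the
    comparison pairs \<open>(\<eta> (x t), x t)\<close>, so that a single Lipschitz constant serves
    all of \<open>{a..b}\<close>.\<close>
  then obtain r where "\<forall>y \<in> (\<lambda>t. (\<xi> t, x t)) ` {a..b} \<union> (\<lambda>t. (\<eta> (x t), x t)) ` {a..b}. norm y \<le> r"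
    unfolding bounded_iff ..
  then have r: "(\<xi> t, x t) \<in> cball 0 r \<and> (\<eta> (x t), x t) \<in> cball 0 r" if "t \<in> {a..b}" for t
    using that by (simp add: ball_Un)
  obtain B where B: "\<And>y y'. y \<in> cball 0 r \<Longrightarrow> y' \<in> cball 0 r \<Longrightarrow>
      norm ((case y of (\<xi>, x) \<Rightarrow> s \<xi> x) - (case y' of (\<xi>, x) \<Rightarrow> s \<xi> x)) \<le> B * norm (y - y')"
    using smooth_on_UNIV_lipschitz_cball[OF s] by blast
  have "norm (e' t) \<le> B * norm (e t)" if "t \<in> {a..b}" for t
    using B[of "(\<eta> (x t), x t)" "(\<xi> t, x t)"] r[OF that] by (simp add: e_def e'_def norm_Pair)
  moreover have "e a = 0 \<or> e b = 0"
    using z0(1) by (simp add: a_def b_def min_def max_def e_def)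
  ultimately have "e a = 0 \<and> e b = 0"
    using gronwall_zero_interval[OF ab(1), of e e' B] de ab(2)
    by (meson has_vector_derivative_within_subset subsetD)
  then have "e t1 = 0"
    by (auto simp: a_def b_def min_def max_def split: if_splits)
  then show "z t1 \<in> ?S"
    using \<phi>0[OF t1] by (auto simp: e_def x_def \<xi>_def split: prod.splits)
qed

section \<open>Mechanical systems\<close>

lemma frechet_derivative_eq_grad:
  fixes f :: "real^'n \<Rightarrow> real"
  assumes "f differentiable at x"
  shows "frechet_derivative f (at x) v = grad f x \<bullet> v"
proof -
  have lin: "linear (frechet_derivative f (at x))"
    by (rule linear_frechet_derivative[OF assms])
  have "frechet_derivative f (at x) v = frechet_derivative f (at x) (\<Sum>i\<in>UNIV. v $ i *\<^sub>R axis i 1)"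
    using basis_expansion[of v] by (simp add: scalar_mult_eq_scaleR)
  also have "\<dots> = (\<Sum>i\<in>UNIV. v $ i *\<^sub>R frechet_derivative f (at x) (axis i 1))"
    using lin by (simp add: linear_sum linear_cmul)
  finally show ?thesis
    by (simp add: grad_def inner_vec_def mult.commute)
qed

lemma frechet_derivative_eq_jacobian:
  fixes f :: "real^'n \<Rightarrow> real^'m"
  assumes "f differentiable at x"
  shows "frechet_derivative f (at x) v = jacobian f (at x) *v v"
  unfolding jacobian_def by (simp add: matrix_works linear_frechet_derivative[OF assms])

lemma grad_compose:
  fixes T :: "real^'n \<Rightarrow> real^'m"
  assumes "T differentiable at q" "g differentiable at (T q)"
  shows "grad (\<lambda>q. g (T q)) q = transpose (jacobian T (at q)) *v grad g (T q)"
proof -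
  have "frechet_derivative (\<lambda>q. g (T q)) (at q) v =
      (transpose (jacobian T (at q)) *v grad g (T q)) \<bullet> v" for v
    using frechet_derivative_compose[OF assms]
    by (simp add: o_def frechet_derivative_eq_grad[OF assms(2)]
        frechet_derivative_eq_jacobian[OF assms(1)] transpose_matrix_vector dot_lmul_matrix)
  then show ?thesis
    unfolding grad_def[of "\<lambda>q. g (T q)"] by (simp add: vec_eq_iff inner_axis)
qed

text \<open>Expresses a partial derivative as a directional derivative of the joint map, for which
  smoothness jointly in both arguments is available.\<close>

lemma frechet_derivative_partial_fst:
  assumes "(f has_derivative frechet_derivative f (at (x, y))) (at (x, y))"
  shows "frechet_derivative (\<lambda>x. f (x, y)) (at x) v = frechet_derivative f (at (x, y)) (v, 0)"
proof -
  have "((\<lambda>x. f (x, y)) has_derivative (\<lambda>v. frechet_derivative f (at (x, y)) (v, 0))) (at x)"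
    by (rule has_derivative_compose[OF has_derivative_Pair[OF has_derivative_ident has_derivative_const] assms])
  from frechet_derivative_at[OF this] show ?thesis by metis
qed

lemma frechet_derivative_partial_snd:
  assumes "(f has_derivative frechet_derivative f (at (x, y))) (at (x, y))"
  shows "frechet_derivative (\<lambda>y. f (x, y)) (at y) v = frechet_derivative f (at (x, y)) (0, v)"
proof -
  have "((\<lambda>y. f (x, y)) has_derivative (\<lambda>v. frechet_derivative f (at (x, y)) (0, v))) (at y)"
    by (rule has_derivative_compose[OF has_derivative_Pair[OF has_derivative_const has_derivative_ident] assms])
  from frechet_derivative_at[OF this] show ?thesis by metis
qed

section \<open>The Hamiltonian and smoothness of the fields\<close>

lemma pos_def_invertible:
  fixes B :: "real^'n^'n"
  assumes "pos_def B"
  shows "invertible B"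
  unfolding invertible_left_inverse matrix_left_invertible_ker
  using assms unfolding pos_def_def by (metis inner_zero_right less_irrefl)

lemma matrix_inv_symmetric:
  fixes B :: "real^'n^'n"
  assumes "invertible B" "transpose B = B"
  shows "transpose (matrix_inv B) = matrix_inv B"
proof -
  have "transpose (matrix_inv B) ** B = mat 1"
    by (metis assms invertible_matrix_inv(1) matrix_transpose_mul transpose_mat)
  then show ?thesis
    by (metis assms(1) invertible_matrix_inv(1) matrix_mul_assoc matrix_mul_lid matrix_mul_rid)
qed

text \<open>The product rule gives two terms, which coincide because the inverse of a symmetric
  matrix is symmetric; this cancels the factor \<open>1/2\<close>.\<close>

lemma grad_hamiltonian_momentum:
  assumes "transpose (M q) = M q" "pos_def (M q)"
  shows "grad (\<lambda>p. hamiltonian M U (q, p)) p = matrix_inv (M q) *v p"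
proof -
  let ?B = "matrix_inv (M q)"
  have sym: "v \<bullet> (?B *v p) = p \<bullet> (?B *v v)" for v
    using matrix_inv_symmetric[OF pos_def_invertible[OF assms(2)] assms(1)]
    by (metis dot_lmul_matrix inner_commute vector_transpose_matrix)
  have "((\<lambda>p. hamiltonian M U (q, p)) has_derivative (\<lambda>v. 1/2 * (p \<bullet> (?B *v v) + v \<bullet> (?B *v p)))) (at p)"
    unfolding hamiltonian_def
    by (auto intro!: derivative_eq_intros bounded_linear.has_derivative[OF matrix_vector_mul_bounded_linear])
  note der = fun_cong[OF frechet_derivative_at[OF this]]
  have "frechet_derivative (\<lambda>p. hamiltonian M U (q, p)) (at p) v = v \<bullet> (?B *v p)" for v
    using der[of v] sym[of v] by simp
  then show ?thesis
    by (simp add: grad_def vec_eq_iff inner_axis')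
qed

lemma smooth_on_hamiltonian:
  fixes M :: "real^'n \<Rightarrow> real^'n^'n"
  assumes "smooth_on UNIV M" "smooth_on UNIV U" "\<And>q. pos_def (M q)"
  shows "smooth_on UNIV (hamiltonian M U)"
proof -
  have Minv: "smooth_on UNIV (\<lambda>q. matrix_inv (M q))"
    using assms(1,3) by (intro smooth_on_matrix_inv pos_def_invertible)
  have fst: "smooth_on UNIV (\<lambda>x :: (real^'n) \<times> (real^'n). fst x)"
    and snd: "smooth_on UNIV (\<lambda>x :: (real^'n) \<times> (real^'n). snd x)"
    by (intro smooth_on_fst smooth_on_snd smooth_on_ident open_UNIV)+
  have "smooth_on UNIV (\<lambda>x. 1/2 * (snd x \<bullet> (matrix_inv (M (fst x)) *v snd x)) + U (fst x))"
    by (intro smooth_on_add smooth_on_mult smooth_on_const smooth_on_inner smooth_on_matrix_vector_mult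
        snd smooth_on_compose_UNIV[OF Minv fst] smooth_on_compose_UNIV[OF assms(2) fst] open_UNIV)
  then show ?thesis
    by (simp add: hamiltonian_def case_prod_unfold)
qed

lemma smooth_on_target:
  fixes w :: "real^2 \<Rightarrow> 'x::euclidean_space \<Rightarrow> real"
  assumes "smooth_on UNIV \<Phi>" "smooth_on UNIV (\<lambda>(\<xi>, x). w \<xi> x)" "smooth_on UNIV RR"
  shows "smooth_on UNIV (\<lambda>(\<xi>, x). target \<Phi> w RR \<xi> x)"
proof -
  have w: "smooth_on UNIV (\<lambda>z. w (fst z) (snd z))"
    using assms(2) by (simp add: case_prod_unfold)
  have fst: "smooth_on UNIV (\<lambda>z :: (real^2) \<times> 'x. fst z)"
    by (intro smooth_on_fst smooth_on_ident open_UNIV)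
  have "smooth_on UNIV (\<lambda>z :: (real^2) \<times> 'x. w (fst z) (snd z) *\<^sub>R (J2 *v grad \<Phi> (fst z)) -
      \<Phi> (fst z) *\<^sub>R (RR (fst z) *v grad \<Phi> (fst z)))"
    by (intro smooth_on_diff smooth_on_scaleR smooth_on_matrix_vector_mult smooth_on_const open_UNIV w
        smooth_on_compose_UNIV[OF smooth_on_grad[OF assms(1)] fst] smooth_on_compose_UNIV[OF assms(1) fst]
        smooth_on_compose_UNIV[OF assms(3) fst])
  then show ?thesis
    by (simp add: target_def case_prod_unfold)
qed

lemma smooth_on_mech_field:
  fixes A :: "real^'a \<Rightarrow> real^'b^'a" and G :: "real^'a \<Rightarrow> real^'m^'b"
  assumes A: "smooth_on UNIV A" and R: "smooth_on UNIV R" and G: "smooth_on UNIV G"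
    and H: "smooth_on UNIV H" and u: "smooth_on UNIV u"
  shows "smooth_on UNIV (\<lambda>x. mech_field A R G H x (u x))"
proof -
  let ?Hq = "\<lambda>x. \<chi> i. frechet_derivative H (at x) (axis i 1, 0)"
  let ?Hp = "\<lambda>x. \<chi> i. frechet_derivative H (at x) (0, axis i 1)"
  have grad: "grad (\<lambda>q. H (q, p)) q = ?Hq (q, p)" "grad (\<lambda>p. H (q, p)) p = ?Hp (q, p)" for q p
    using frechet_derivative_partial_fst[OF smooth_on_has_derivative[OF H UNIV_I]]
      frechet_derivative_partial_snd[OF smooth_on_has_derivative[OF H UNIV_I]]
    by (simp_all add: grad_def)
  have fst: "smooth_on UNIV (\<lambda>x :: (real^'a) \<times> (real^'b). fst x)"
    by (intro smooth_on_fst smooth_on_ident open_UNIV)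
  have Hq: "smooth_on UNIV ?Hq" and Hp: "smooth_on UNIV ?Hp"
    by (rule smooth_on_vecI, simp, rule smooth_on_frechet_apply[OF H])+
  have "smooth_on UNIV (\<lambda>x. (A (fst x) *v ?Hp x,
      - (transpose (A (fst x)) *v ?Hq x) - R x *v ?Hp x + G (fst x) *v u x))"
    by (intro smooth_on_Pair smooth_on_add smooth_on_diff smooth_on_uminus smooth_on_matrix_vector_mult
        smooth_on_transpose Hq Hp R u smooth_on_compose_UNIV[OF A fst] smooth_on_compose_UNIV[OF G fst])
  then show ?thesis
    by (simp add: mech_field_def case_prod_unfold grad)
qed

text \<open>If \<open>W ** transpose W\<close> kills \<open>x\<close>, then pairing with
  \<open>x\<close> shows that \<open>transpose W *v x\<close> has norm zero, and full row rank makes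
  \<open>transpose W\<close> injective.\<close>

lemma full_row_rank_right_inverse:
  fixes W :: "real^'m^'k"
  assumes "rank W = CARD('k)"
  shows "invertible (W ** transpose W)"
    and "W *v (transpose W *v (matrix_inv (W ** transpose W) *v v)) = v"
proof -
  have inj: "transpose W *v x = 0 \<Longrightarrow> x = 0" for x
    using full_rank_injective[of "transpose W"] assms
    by (metis inj_onD matrix_vector_mult_0_right rank_transpose UNIV_I)
  have "x = 0" if "(W ** transpose W) *v x = 0" for x
  proof (rule inj)
    have "(transpose W *v x) \<bullet> (transpose W *v x) = x \<bullet> ((W ** transpose W) *v x)"
      by (simp only: matrix_vector_mul_assoc[symmetric] dot_lmul_matrix[symmetric] transpose_matrix_vector)
    then show "transpose W *v x = 0" using that by simp
  qed
  then show inv: "invertible (W ** transpose W)"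
    unfolding invertible_left_inverse matrix_left_invertible_ker by blast
  show "W *v (transpose W *v (matrix_inv (W ** transpose W) *v v)) = v"
    using invertible_matrix_inv(1)[OF inv] by (simp add: matrix_vector_mul_assoc matrix_mul_assoc)
qed

lemma mech_field_input:
  "mech_field A R G H (q, p) u = mech_field A R G H (q, p) 0 + (0, G q *v u)"
  by (simp add: mech_field_def)

text \<open>The input acts on \<open>\<phi>\<close> through the matrix \<open>W = \<partial>\<phi>/\<partial>p G\<close>; a right inverse of \<open>W\<close> cancels the drift.\<close>

lemma constraint_preserving_feedback:
  fixes A :: "real^'a \<Rightarrow> real^'b^'a" and G :: "real^'a \<Rightarrow> real^'m^'b"
    and \<phi> :: "(real^'a) \<times> (real^'b) \<Rightarrow> real^'k"
  assumes A: "smooth_on UNIV A" and R: "smooth_on UNIV R" and G: "smooth_on UNIV G"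
    and H: "smooth_on UNIV H" and \<phi>: "smooth_on UNIV \<phi>"
    and rank: "\<And>q p. rank (jacobian (\<lambda>p. \<phi> (q, p)) (at p) ** G q) = CARD('k)"
  obtains u where "smooth_on UNIV u"
    and "\<And>x. frechet_derivative \<phi> (at x) (mech_field A R G H x (u x)) = 0"
proof -
  \<comment> \<open>The momentum Jacobian is written through the joint derivative of
    \<open>\<phi>\<close>, so that \<open>W\<close> is visibly smooth in the whole state;
    \<open>jac\<close> identifies the two forms.\<close>
  define W where "W = (\<lambda>x. (\<chi> i j. frechet_derivative \<phi> (at x) (0, axis j 1) $ i) ** G (fst x))"
  define d where "d = (\<lambda>x. frechet_derivative \<phi> (at x) (mech_field A R G H x 0))"
  \<comment> \<open>\<open>d\<close> is the drift of \<open>\<phi>\<close> without input. The right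
    inverse of \<open>W\<close> yields \<open>W x *v u x = - d x\<close>, and since the field is
    affine in the input the two contributions cancel.\<close>
  define u where "u = (\<lambda>x. transpose (W x) *v (matrix_inv (W x ** transpose (W x)) *v (- d x)))"
  have jac: "(\<chi> i j. frechet_derivative \<phi> (at (q, p)) (0, axis j 1) $ i) = jacobian (\<lambda>p. \<phi> (q, p)) (at p)" for q p
    using frechet_derivative_partial_snd[OF smooth_on_has_derivative[OF \<phi> UNIV_I]]
    by (simp add: jacobian_def matrix_def)
  have W: "rank (W x) = CARD('k)" for x
    using rank[of "fst x" "snd x"] jac[of "fst x" "snd x"] by (simp add: W_def)
  have Wsm: "smooth_on UNIV W"
    unfolding W_def
  proof (rule smooth_on_matrix_mult)
    show "smooth_on UNIV (\<lambda>x. \<chi> i j. frechet_derivative \<phi> (at x) (0, axis j 1) $ i)"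
      by (rule smooth_on_vecI, rule smooth_on_vecI, simp) (rule smooth_on_nth, rule smooth_on_frechet_apply[OF \<phi>])
    show "smooth_on UNIV (\<lambda>x. G (fst x))"
      by (rule smooth_on_compose_UNIV[OF G smooth_on_fst[OF smooth_on_ident[OF open_UNIV]]])
  qed
  have dsm: "smooth_on UNIV d"
    unfolding d_def
    by (rule smooth_on_frechet[OF \<phi> smooth_on_mech_field[OF A R G H smooth_on_const[OF open_UNIV]]])
  have "smooth_on UNIV u"
    unfolding u_def
    by (intro smooth_on_matrix_vector_mult smooth_on_transpose smooth_on_matrix_inv smooth_on_matrix_mult
        Wsm smooth_on_uminus dsm full_row_rank_right_inverse(1) W)
  moreover have "frechet_derivative \<phi> (at x) (mech_field A R G H x (u x)) = 0" for x
  proof -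
    obtain q p where x: "x = (q, p)" by (cases x)
    have lin: "linear (frechet_derivative \<phi> (at x))"
      by (rule has_derivative_linear[OF smooth_on_has_derivative[OF \<phi> UNIV_I]])
    have diff: "(\<lambda>p. \<phi> (q, p)) differentiable (at p)"
      using has_derivative_compose[OF has_derivative_Pair[OF has_derivative_const has_derivative_ident]
          smooth_on_has_derivative[OF \<phi> UNIV_I]]
      unfolding differentiable_def by blast
    have "frechet_derivative \<phi> (at x) (0, G q *v u x) = W x *v u x"
      using frechet_derivative_partial_snd[OF smooth_on_has_derivative[OF \<phi> UNIV_I], of q p "G q *v u x"]
        frechet_derivative_eq_jacobian[OF diff, of "G q *v u x"]
      by (simp add: W_def x jac matrix_vector_mul_assoc)
    also have "\<dots> = - d x"
      unfolding u_def by (rule full_row_rank_right_inverse(2)[OF W])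
    finally show ?thesis
      using lin unfolding x by (subst mech_field_input) (simp add: linear_add d_def)
  qed
  ultimately show thesis by (rule that)
qed

section \<open>Change of coordinates\<close>

lemma col_nth [simp]: "col u v $ Inl i = u $ i" "col u v $ Inr j = v $ j"
  by (simp_all add: col_def)

lemma vec_sum_eq_iff:
  fixes y z :: "'a^('m::finite + 'n::finite)"
  shows "y = z \<longleftrightarrow> (\<forall>i. y $ Inl i = z $ Inl i) \<and> (\<forall>j. y $ Inr j = z $ Inr j)"
  unfolding vec_eq_iff by (metis sum.exhaust)

lemma linear_col: "linear (\<lambda>(u :: real^'m, v :: real^'n). col u v)"
  by (rule linearI) (auto simp: vec_sum_eq_iff)

text \<open>Differentiate \<open>inv T (T q) = q\<close>; \<open>inv T\<close> is differentiable at
  \<open>T q\<close> because its smoothness on \<open>range T\<close> includes openness of that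
  set.\<close>

lemma frechet_derivative_inv_diffeomorphism:
  fixes T :: "'a::euclidean_space \<Rightarrow> 'b::euclidean_space"
  assumes "diffeomorphism_onto_image T"
  shows "frechet_derivative (inv T) (at (T q)) (frechet_derivative T (at q) v) = v"
proof -
  have T: "inj T" "smooth_on UNIV T" "smooth_on (range T) (inv T)"
    using assms by (simp_all add: diffeomorphism_onto_image_def)
  have "((\<lambda>q. inv T (T q)) has_derivative
      (\<lambda>v. frechet_derivative (inv T) (at (T q)) (frechet_derivative T (at q) v))) (at q)"
    by (rule has_derivative_compose[OF smooth_on_has_derivative[OF T(2) UNIV_I]
          smooth_on_has_derivative[OF T(3) rangeI]])
  then have "((\<lambda>q. q) has_derivative
      (\<lambda>v. frechet_derivative (inv T) (at (T q)) (frechet_derivative T (at q) v))) (at q)"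
    using T(1) by simp
  from fun_cong[OF has_derivative_unique[OF this has_derivative_ident]] show ?thesis .
qed

text \<open>The new field is the pushforward of the old one. The Jacobian factor produces the new
  position velocity; in the momentum block its transpose turns the gradient of \<open>H\<close>
  composed with \<open>inv T\<close> back into the gradient of \<open>H\<close>, by the chain
  rule.\<close>

lemma new_mech_field_to_new:
  fixes T :: "real^'n \<Rightarrow> real^'r" and G :: "real^'n \<Rightarrow> real^'m^'n"
  assumes T: "diffeomorphism_onto_image T" and H: "smooth_on UNIV H"
  shows "new_mech_field T A R G H (T q, p) u =
    (frechet_derivative T (at q) (fst (mech_field A R G H (q, p) u)), snd (mech_field A R G H (q, p) u))"
proof -
  have T': "inj T" "smooth_on UNIV T" "smooth_on (range T) (inv T)"
    using T by (simp_all add: diffeomorphism_onto_image_def)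
  have dT: "T differentiable (at q)"
    using smooth_on_has_derivative[OF T'(2) UNIV_I] unfolding differentiable_def by blast
  have "((\<lambda>y. H (inv T y, p)) has_derivative
      (\<lambda>v. frechet_derivative H (at (inv T (T q), p)) (frechet_derivative (inv T) (at (T q)) v, 0))) (at (T q))"
    by (rule has_derivative_compose[OF has_derivative_Pair[OF smooth_on_has_derivative[OF T'(3) rangeI]
            has_derivative_const] smooth_on_has_derivative[OF H UNIV_I]])
  then have "(\<lambda>y. H (inv T y, p)) differentiable (at (T q))"
    unfolding differentiable_def by blast
  from grad_compose[OF dT this]
  have "transpose (jacobian T (at q)) *v grad (\<lambda>y. H (inv T y, p)) (T q) = grad (\<lambda>q. H (q, p)) q"
    using T'(1) by simp
  then show ?thesis
    using T'(1)
    by (simp add: new_mech_field_def mech_field_def to_old_def frechet_derivative_eq_jacobian[OF dT]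
        matrix_vector_mul_assoc[symmetric] matrix_transpose_mul)
qed

lemma exists_linear_inj:
  assumes "DIM('a) \<le> DIM('b)"
  obtains E :: "'a::euclidean_space \<Rightarrow> 'b::euclidean_space" where "linear E" "inj E"
proof -
  obtain E :: "'a \<Rightarrow> 'b" where "linear E" "\<And>x. x \<in> UNIV \<Longrightarrow> norm (E x) = norm x"
    using isometry_subset_subspace[of "UNIV :: 'a set" "UNIV :: 'b set"] assms by auto
  then show thesis
    using that by (metis linear_injective_0 norm_eq_zero UNIV_I)
qed

text \<open>Any smooth constraint \<open>\<phi>\<close> that the feedback preserves and that forces the output velocity to match
  the target yields the immersion: the output block of \<open>\<pi> \<xi> x\<close> is \<open>\<xi>\<close>, and its momentum block is shifted
  by an injective linear image of \<open>\<phi>\<close>, so that \<open>x = \<pi> \<xi> x\<close> encodes both \<open>h q = \<xi>\<close> and \<open>\<phi> = 0\<close>.\<close>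

lemma immersion_of_constraint:
  fixes A M :: "real^'n \<Rightarrow> real^'n^'n"
    and R :: "(real^'n) \<times> (real^'n) \<Rightarrow> real^'n^'n"
    and G :: "real^'n \<Rightarrow> real^'m^'n"
    and h :: "real^'n \<Rightarrow> real^2"
    and N :: "real^'n \<Rightarrow> real^'k"
    and T :: "real^'n \<Rightarrow> real^(2 + 'k)"
    and s :: "real^2 \<Rightarrow> (real^'n) \<times> (real^'n) \<Rightarrow> real^2"
    and \<phi> :: "(real^'n) \<times> (real^'n) \<Rightarrow> real^2"
    and u :: "(real^'n) \<times> (real^'n) \<Rightarrow> real^'m"
  assumes dim: "2 \<le> CARD('n)"
    and M: "\<And>q. transpose (M q) = M q" "\<And>q. pos_def (M q)"
    and H: "smooth_on UNIV (hamiltonian M U)"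
    and h: "smooth_on UNIV h" and N: "smooth_on UNIV N"
    and Tcol: "\<And>q. T q = col (h q) (N q)" and T: "diffeomorphism_onto_image T"
    and s: "smooth_on UNIV (\<lambda>(\<xi>, x). s \<xi> x)"
    and \<phi>: "smooth_on UNIV \<phi>" and u: "smooth_on UNIV u"
    and \<phi>u: "\<And>x. frechet_derivative \<phi> (at x) (mech_field A R G (hamiltonian M U) x (u x)) = 0"
    and \<phi>0: "\<And>q p. \<phi> (q, p) = 0 \<Longrightarrow> velocity_mismatch h A M s q p = 0"
  obtains \<pi> :: "real^2 \<Rightarrow> (real^(2 + 'k)) \<times> (real^'n) \<Rightarrow> (real^(2 + 'k)) \<times> (real^'n)"
    and c :: "real^2 \<Rightarrow> (real^(2 + 'k)) \<times> (real^'n) \<Rightarrow> real^'m"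
  where "smooth_on (new_states T \<times> UNIV) (\<lambda>(x, \<xi>). \<pi> \<xi> x)"
    and "smooth_on (new_states T \<times> UNIV) (\<lambda>(x, \<xi>). c \<xi> x)"
    and "\<forall>\<xi> x. (\<lambda>\<zeta>. \<pi> \<zeta> x) differentiable (at \<xi>) \<and>
       dim (range (frechet_derivative (\<lambda>\<zeta>. \<pi> \<zeta> x) (at \<xi>))) = 2"
    and "invariant_set (new_states T \<times> UNIV)
       (closed_loop (new_mech_field T A R G (hamiltonian M U)) (\<lambda>\<xi> x. s \<xi> (to_old T x)) c)
       (immersed_manifold (new_states T) \<pi>)"
    and "immersion_equation (new_states T)
       (closed_loop (new_mech_field T A R G (hamiltonian M U)) (\<lambda>\<xi> x. s \<xi> (to_old T x)) c) \<pi>"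
    and "\<forall>x. \<phi> x = 0 \<longleftrightarrow> (\<exists>\<xi>. to_new T x = \<pi> \<xi> (to_new T x))"
    and "invariant_set UNIV (closed_loop (mech_field A R G (hamiltonian M U)) s (\<lambda>\<xi> x. c \<xi> (to_new T x)))
       ({((q, p), \<xi>). h q = \<xi>} \<inter> {(x, \<xi>). \<phi> x = 0})"
proof -
  have T': "inj T" "smooth_on UNIV T" "smooth_on (range T) (inv T)"
    using T by (simp_all add: diffeomorphism_onto_image_def)
  \<comment> \<open>Embeds the two values of \<open>\<phi>\<close> into momentum space without
    losing its zero set.\<close>
  obtain E :: "real^2 \<Rightarrow> real^'n" where E: "linear E" "inj E"
    using exists_linear_inj[where 'a = "real^2" and 'b = "real^'n"] dim by auto
  define X where "X = (\<lambda>x. mech_field A R G (hamiltonian M U) x (u x))"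
  define c where "c = (\<lambda>(\<xi> :: real^2) x. u (to_old T x))"
  \<comment> \<open>Overwrites the output block of the position by \<open>\<xi>\<close> and keeps
    the \<open>N\<close>-block. It is linear in state and \<open>\<xi>\<close> together, hence its
    own derivative.\<close>
  define L :: "((real^(2 + 'k)) \<times> (real^'n)) \<times> (real^2) \<Rightarrow> real^(2 + 'k)"
    where "L = (\<lambda>z. col (snd z) (\<chi> j. fst (fst z) $ Inr j))"
  define \<pi> where "\<pi> = (\<lambda>\<xi> x. (L (x, \<xi>), snd x + E (\<phi> (to_old T x))))"
  define Z' where "Z' = closed_loop (new_mech_field T A R G (hamiltonian M U)) (\<lambda>\<xi> x. s \<xi> (to_old T x)) c"
  define Z where "Z = closed_loop (mech_field A R G (hamiltonian M U)) s (\<lambda>\<xi> x. c \<xi> (to_new T x))"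
  define D :: "(((real^(2 + 'k)) \<times> (real^'n)) \<times> (real^2)) set" where "D = new_states T \<times> UNIV"
  define S where "S = {(x, \<xi>). h (fst x) = \<xi> \<and> \<phi> x = 0}"
  define \<kappa> :: "((real^(2 + 'k)) \<times> (real^'n)) \<times> (real^2) \<Rightarrow> ((real^'n) \<times> (real^'n)) \<times> (real^2)"
    where "\<kappa> = (\<lambda>z. (to_old T (fst z), snd z))"
  have L: "linear L"
    unfolding L_def by (rule linearI) (auto simp: vec_sum_eq_iff)
  have to_old_new: "to_old T (to_new T x) = x" for x
    using T'(1) by (simp add: to_old_def to_new_def split: prod.split)
  have openD: "open D"
    using smooth_on_open[OF T'(3)] by (simp add: D_def new_states_def open_Times)
  have D_cases: "\<exists>q p \<xi>. z = ((T q, p), \<xi>)" if "z \<in> D" for z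
    using that by (cases z) (auto simp: D_def new_states_def)
  have id: "smooth_on D (\<lambda>z. z)"
    by (rule smooth_on_ident[OF openD])
  have "smooth_on D (\<lambda>z. inv T (fst (fst z)))"
    by (rule smooth_on_compose[OF T'(3) smooth_on_fst[OF smooth_on_fst[OF id]]])
      (auto simp: D_def new_states_def)
  then have old: "smooth_on D (\<lambda>z. to_old T (fst z))"
    unfolding to_old_def case_prod_unfold by (intro smooth_on_Pair smooth_on_snd smooth_on_fst id)
  have \<kappa>: "smooth_on D \<kappa>"
    unfolding \<kappa>_def by (intro smooth_on_Pair old smooth_on_snd id)
  have \<pi>D: "smooth_on D (\<lambda>z. (L z, snd (fst z) + E (\<phi> (to_old T (fst z)))))"
    by (intro smooth_on_Pair smooth_on_add smooth_on_linear[OF L id] smooth_on_snd smooth_on_fst id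
        smooth_on_linear[OF E(1)] smooth_on_compose_UNIV[OF \<phi> old])
  have cD: "smooth_on D (\<lambda>z. u (to_old T (fst z)))"
    by (rule smooth_on_compose_UNIV[OF u old])

  have \<kappa>': "(\<kappa> has_derivative
      (\<lambda>v. ((frechet_derivative (inv T) (at (T q)) (fst (fst v)), snd (fst v)), snd v))) (at ((T q, p), \<xi>))"
    for q p \<xi>
    unfolding \<kappa>_def to_old_def case_prod_unfold
    by (intro has_derivative_Pair has_derivative_snd has_derivative_fst has_derivative_ident
        has_derivative_compose[of "\<lambda>z. fst (fst z)" _ _ _ "inv T"])
      (simp add: smooth_on_has_derivative[OF T'(3)])
  have \<phi>X: "frechet_derivative \<phi> (at x) (X x) = 0" for x
    unfolding X_def by (rule \<phi>u)
  have X_eq: "fst (X (q, p)) = A q *v (matrix_inv (M q) *v p)" for q p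
    by (simp add: X_def mech_field_def grad_hamiltonian_momentum[OF M])
  have Z'_eq: "Z' ((T q, p), \<xi>) =
      ((frechet_derivative T (at q) (fst (X (q, p))), snd (X (q, p))), s \<xi> (q, p))" for q p \<xi>
    using T'(1) by (simp add: Z'_def closed_loop_def c_def to_old_def X_def new_mech_field_to_new[OF T H])
  have Z_eq: "Z = (\<lambda>(x, \<xi>). (X x, s \<xi> x))"
    by (simp add: Z_def closed_loop_def c_def to_old_new X_def)
  \<comment> \<open>The two closed loops are \<open>\<kappa>\<close>-related: the derivatives of
    \<open>T\<close> and \<open>inv T\<close> cancel on the position block.\<close>
  have conj: "((frechet_derivative (inv T) (at (T q)) (fst (fst (Z' ((T q, p), \<xi>)))),
      snd (fst (Z' ((T q, p), \<xi>)))), snd (Z' ((T q, p), \<xi>))) = Z ((q, p), \<xi>)" for q p \<xi>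
    by (simp add: Z'_eq Z_eq frechet_derivative_inv_diffeomorphism[OF T])
  have \<kappa>_eq: "\<kappa> ((T q, p), \<xi>) = ((q, p), \<xi>)" for q p \<xi>
    using T'(1) by (simp add: \<kappa>_def to_old_def)

  \<comment> \<open>The \<open>N\<close>-block of the fixed-point equation is trivial, the output
    block says \<open>h q = \<xi>\<close>, and the momentum block says
    \<open>E (\<phi> x) = 0\<close>.\<close>
  have \<pi>_iff: "to_new T x = \<pi> \<xi> (to_new T x) \<longleftrightarrow> h (fst x) = \<xi> \<and> \<phi> x = 0" for x \<xi>
  proof -
    obtain q p where x: "x = (q, p)" by (cases x)
    have "E v = 0 \<longleftrightarrow> v = 0" for v
      using E by (metis linear_0 linear_injective_0)
    moreover have "col (h q) (N q) = col \<xi> (N q) \<longleftrightarrow> h q = \<xi>"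
      by (auto simp: vec_sum_eq_iff vec_eq_iff)
    moreover have "to_old T (col (h q) (N q), p) = (q, p)"
      using to_old_new[of "(q, p)"] by (simp add: to_new_def Tcol)
    ultimately show ?thesis
      by (simp add: x \<pi>_def to_new_def L_def Tcol)
  qed
  \<comment> \<open>Being a \<open>\<kappa>\<close>-preimage of \<open>S\<close>, the manifold
    inherits invariance from \<open>S\<close> in the original coordinates.\<close>
  have manifold: "immersed_manifold (new_states T) \<pi> = {z \<in> D. \<kappa> z \<in> S}"
  proof (intro set_eqI)
    fix z :: "((real^(2 + 'k)) \<times> (real^'n)) \<times> (real^2)"
    show "z \<in> immersed_manifold (new_states T) \<pi> \<longleftrightarrow> z \<in> {z \<in> D. \<kappa> z \<in> S}"
    proof (cases "z \<in> D")
      case True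
      then obtain q p \<xi> where z: "z = ((T q, p), \<xi>)"
        using D_cases by blast
      show ?thesis
        using True \<pi>_iff[of "(q, p)" \<xi>]
        by (simp add: z immersed_manifold_def \<kappa>_eq S_def to_new_def D_def new_states_def)
    qed (auto simp: immersed_manifold_def D_def)
  qed

  have h': "((\<lambda>x. h (fst x)) has_derivative (\<lambda>v. frechet_derivative h (at (fst x)) (fst v))) (at x)" for x :: "(real^'n) \<times> (real^'n)"
    by (rule has_derivative_compose[OF has_derivative_fst[OF has_derivative_ident] smooth_on_has_derivative[OF h UNIV_I]])
  have hX: "frechet_derivative h (at q) (fst (X (q, p))) = s (h q) (q, p)" if "\<phi> (q, p) = 0" for q p
    using \<phi>0[OF that] smooth_on_has_derivative[OF h UNIV_I, of q]
    by (simp add: X_eq velocity_mismatch_def matrix_vector_mul_assoc[symmetric]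
        frechet_derivative_eq_jacobian differentiableI)
  have invZ: "invariant_set UNIV Z S"
    unfolding Z_eq S_def
  proof (rule invariant_set_output_tracking[OF _ \<phi> s])
    show "smooth_on UNIV (\<lambda>x :: (real^'n) \<times> (real^'n). h (fst x))"
      by (rule smooth_on_compose_UNIV[OF h smooth_on_fst[OF smooth_on_ident[OF open_UNIV]]])
    show "frechet_derivative \<phi> (at x) (X x) = 0" for x
      by (rule \<phi>X)
    show "frechet_derivative (\<lambda>x. h (fst x)) (at x) (X x) = s (h (fst x)) x" if "\<phi> x = 0" for x
      using hX[of "fst x" "snd x"] that fun_cong[OF frechet_derivative_at[OF h'[of x]], of "X x"] by simp
  qed
  have invZ': "invariant_set D Z' (immersed_manifold (new_states T) \<pi>)"
    unfolding manifold
  proof (rule invariant_set_pullback[OF invZ UNIV_I])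
    fix z assume "z \<in> D"
    then obtain q p \<xi> where z: "z = ((T q, p), \<xi>)"
      using D_cases by blast
    show "(\<kappa> has_derivative frechet_derivative \<kappa> (at z)) (at z)"
      by (rule smooth_on_has_derivative[OF \<kappa> \<open>z \<in> D\<close>])
    show "frechet_derivative \<kappa> (at z) (Z' z) = Z (\<kappa> z)"
      unfolding z frechet_derivative_at[OF \<kappa>', symmetric] \<kappa>_eq by (rule conj)
  qed

  have eq: "immersion_equation (new_states T) Z' \<pi>"
    unfolding immersion_equation_def manifold
  proof (clarify)
    fix y p \<xi> assume "((y, p), \<xi>) \<in> D" and S: "\<kappa> ((y, p), \<xi>) \<in> S"
    then obtain q where y: "y = T q"
      using D_cases by fastforce
    let ?z = "((y, p), \<xi>)"
    have hq: "h q = \<xi>" and \<phi>q: "\<phi> (q, p) = 0"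
      using S unfolding y \<kappa>_eq by (simp_all add: S_def)
    have "((\<lambda>z. \<phi> (to_old T (fst z))) has_derivative
        (\<lambda>v. frechet_derivative \<phi> (at (q, p)) (frechet_derivative (inv T) (at (T q)) (fst (fst v)), snd (fst v)))) (at ?z)"
      using has_derivative_compose[OF has_derivative_fst[OF \<kappa>'[of q p \<xi>]], of \<phi> "frechet_derivative \<phi> (at (q, p))"]
        smooth_on_has_derivative[OF \<phi> UNIV_I] T'(1)
      by (simp add: \<kappa>_def y to_old_def)
    from has_derivative_compose[OF this linear_imp_has_derivative[OF E(1)]]
    have "((\<lambda>(x, \<xi>). \<pi> \<xi> x) has_derivative (\<lambda>v. (L v, snd (fst v) + E (frechet_derivative \<phi> (at (q, p))
        (frechet_derivative (inv T) (at (T q)) (fst (fst v)), snd (fst v)))))) (at ?z)"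
      unfolding \<pi>_def case_prod_unfold prod.collapse
      by (intro has_derivative_Pair linear_imp_has_derivative[OF L] has_derivative_add has_derivative_snd
          has_derivative_fst has_derivative_ident)
    from fun_cong[OF frechet_derivative_at[OF this], of "Z' ?z"]
    have "frechet_derivative (\<lambda>(x, \<xi>). \<pi> \<xi> x) (at ?z) (Z' ?z) =
        (L (Z' ?z), snd (fst (Z' ?z)) + E (frechet_derivative \<phi> (at (q, p)) (X (q, p))))"
      unfolding y Z'_eq by (simp add: frechet_derivative_inv_diffeomorphism[OF T])
    \<comment> \<open>The momentum shift has zero velocity because the feedback keeps
      \<open>\<phi>\<close> constant.\<close>
    also have "\<dots> = (L (Z' ?z), snd (X (q, p)))"
      using E(1) by (simp add: \<phi>X linear_0 y Z'_eq)
    \<comment> \<open>In the output block \<open>L\<close> carries the velocity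
      \<open>s \<xi> (q, p)\<close> of \<open>\<xi>\<close>; with \<open>h q = \<xi>\<close> this is
      the velocity of \<open>h q\<close> by \<open>hX\<close>, so both blocks of the derivative of
      \<open>T\<close> appear.\<close>
    also have "L (Z' ?z) = frechet_derivative T (at q) (fst (X (q, p)))"
    proof -
      have "(T has_derivative (\<lambda>v. col (frechet_derivative h (at q) v) (frechet_derivative N (at q) v))) (at q)"
        using has_derivative_compose[OF has_derivative_Pair[OF smooth_on_has_derivative[OF h UNIV_I]
              smooth_on_has_derivative[OF N UNIV_I]] linear_imp_has_derivative[OF linear_col]]
        by (simp add: Tcol[symmetric])
      from fun_cong[OF frechet_derivative_at[OF this], symmetric]
      show ?thesis
        using hX[OF \<phi>q] by (simp add: y Z'_eq L_def hq vec_lambda_eta)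
    qed
    finally show "fst (Z' ?z) = frechet_derivative (\<lambda>(x, \<xi>). \<pi> \<xi> x) (at ?z) (Z' ?z)"
      by (simp add: y Z'_eq)
  qed

  \<comment> \<open>For fixed \<open>x\<close>, \<open>\<pi>\<close> is affine in
    \<open>\<zeta>\<close>, with linear part the injection of the plane into the output
    block.\<close>
  have rank: "(\<lambda>\<zeta>. \<pi> \<zeta> x) differentiable (at \<xi>) \<and>
      dim (range (frechet_derivative (\<lambda>\<zeta>. \<pi> \<zeta> x) (at \<xi>))) = 2" for \<xi> x
  proof -
    let ?l = "\<lambda>v :: real^2. (L (0, v), 0 :: real^'n)"
    have lin: "linear ?l"
      by (rule linearI) (auto simp: L_def vec_sum_eq_iff)
    have "inj ?l"
      by (rule injI) (auto simp: L_def vec_sum_eq_iff vec_eq_iff)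
    have "(\<lambda>\<zeta>. \<pi> \<zeta> x) = (\<lambda>\<zeta>. ?l \<zeta> + \<pi> 0 x)"
      by (auto simp: \<pi>_def L_def vec_sum_eq_iff fun_eq_iff)
    then have der: "((\<lambda>\<zeta>. \<pi> \<zeta> x) has_derivative ?l) (at \<xi>)"
      using has_derivative_add[OF linear_imp_has_derivative[OF lin] has_derivative_const, of "\<pi> 0 x" "at \<xi>"]
      by simp
    have "dim (range ?l) = DIM(real^2)"
      using dim_image_eq[OF lin, of UNIV] \<open>inj ?l\<close> by (simp add: inj_on_subset)
    then show ?thesis
      using der unfolding frechet_derivative_at[OF der, symmetric] differentiable_def by auto
  qed

  show thesis
  proof (rule that)
    show "smooth_on (new_states T \<times> UNIV) (\<lambda>(x, \<xi>). \<pi> \<xi> x)"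
      using \<pi>D by (simp add: D_def \<pi>_def case_prod_unfold)
    show "smooth_on (new_states T \<times> UNIV) (\<lambda>(x, \<xi>). c \<xi> x)"
      using cD by (simp add: D_def c_def case_prod_unfold)
    show "\<forall>x. \<phi> x = 0 \<longleftrightarrow> (\<exists>\<xi>. to_new T x = \<pi> \<xi> (to_new T x))"
      by (simp add: \<pi>_iff)
    have "{((q, p), \<xi>). h q = \<xi>} \<inter> {(x, \<xi>). \<phi> x = 0} = S"
      by (auto simp: S_def)
    then show "invariant_set UNIV
        (closed_loop (mech_field A R G (hamiltonian M U)) s (\<lambda>\<xi> x. c \<xi> (to_new T x)))
        ({((q, p), \<xi>). h q = \<xi>} \<inter> {(x, \<xi>). \<phi> x = 0})"
      using invZ by (simp add: Z_def)
  qed (use rank invZ' eq in \<open>simp_all add: D_def Z'_def\<close>)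
qed

text \<open>Invariance of \<open>h q = \<xi>\<close> is asserted on \<open>\<phi> x = 0\<close>
  because the input does not enter the velocity of \<open>h q - \<xi>\<close>. If \<open>w\<close>
  depends on \<open>p\<close>, so does the target, which changes the momentum Jacobian of the
  mismatch; hence the separate rank premise before \<open>\<phi>\<close> is identified with the zero
  set of the mismatch. For \<open>w\<close> independent of \<open>p\<close> that premise is the
  assumed rank condition on
  \<open>jacobian h (at q) ** A q ** matrix_inv (M q) ** G q\<close>.\<close>

theorem proposition3:
  fixes A M :: "real^'n \<Rightarrow> real^'n^'n"
    and R :: "(real^'n) \<times> (real^'n) \<Rightarrow> real^'n^'n"
    and G :: "real^'n \<Rightarrow> real^'m^'n"
    and U :: "real^'n \<Rightarrow> real"
    and h :: "real^'n \<Rightarrow> real^2"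
    and N :: "real^'n \<Rightarrow> real^'k"
    and \<Phi> :: "real^2 \<Rightarrow> real"
    and w :: "real^2 \<Rightarrow> (real^'n) \<times> (real^'n) \<Rightarrow> real"
    and RR :: "real^2 \<Rightarrow> real^2^2"
    and T :: "real^'n \<Rightarrow> real^(2 + 'k)"
  assumes "2 \<le> CARD('m)" and "CARD('m) < CARD('n)" and "CARD('n) = CARD('k) + 2"
    and "smooth_on UNIV A" and "\<And>q. rank (A q) = CARD('n)"
    and "smooth_on UNIV M" and "\<And>q. transpose (M q) = M q" and "\<And>q. pos_def (M q)"
    and "smooth_on UNIV R" and "\<And>x. pos_semidef (R x + transpose (R x))"
    and "smooth_on UNIV G" and "\<And>q. rank (G q) = CARD('m)"
    and "smooth_on UNIV U"
    and "smooth_on UNIV h" and "\<And>q. rank (jacobian h (at q)) = 2"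
    and "smooth_on UNIV N"
    and "admissible_path \<Phi>"
    and "\<And>q. rank (jacobian h (at q) ** A q ** matrix_inv (M q) ** G q) = 2"
    and "\<And>q. T q = col (h q) (N q)" and "diffeomorphism_onto_image T"
    and "smooth_on UNIV (\<lambda>(\<xi>, x). w \<xi> x)"
    and "smooth_on UNIV RR" and "\<And>\<xi>. pos_def (RR \<xi>)"
  shows "\<exists>(\<pi> :: real^2 \<Rightarrow> (real^(2 + 'k)) \<times> (real^'n) \<Rightarrow> (real^(2 + 'k)) \<times> (real^'n))
          (\<phi> :: (real^'n) \<times> (real^'n) \<Rightarrow> real^2)
          (c :: real^2 \<Rightarrow> (real^(2 + 'k)) \<times> (real^'n) \<Rightarrow> real^'m).
    smooth_on (new_states T \<times> UNIV) (\<lambda>(x, \<xi>). \<pi> \<xi> x) \<and>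
    smooth_on UNIV \<phi> \<and>
    smooth_on (new_states T \<times> UNIV) (\<lambda>(x, \<xi>). c \<xi> x) \<and>
    (\<forall>\<xi> x. (\<lambda>\<zeta>. \<pi> \<zeta> x) differentiable (at \<xi>) \<and>
       dim (range (frechet_derivative (\<lambda>\<zeta>. \<pi> \<zeta> x) (at \<xi>))) = 2) \<and>
    (let s = target \<Phi> w RR;
         H = hamiltonian M U;
         Z' = closed_loop (new_mech_field T A R G H) (\<lambda>\<xi> x. s \<xi> (to_old T x)) c;
         Z = closed_loop (mech_field A R G H) s (\<lambda>\<xi> x. c \<xi> (to_new T x))
     in
       invariant_set (new_states T \<times> UNIV) Z' (immersed_manifold (new_states T) \<pi>) \<and>
       immersion_equation (new_states T) Z' \<pi> \<and>
       (\<forall>x. \<phi> x = 0 \<longleftrightarrow> (\<exists>\<xi>. to_new T x = \<pi> \<xi> (to_new T x))) \<and>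
       invariant_set UNIV Z ({((q, p), \<xi>). h q = \<xi>} \<inter> {(x, \<xi>). \<phi> x = 0}) \<and>
       ((\<forall>q p. rank (jacobian (velocity_mismatch h A M s q) (at p) ** G q) = 2) \<longrightarrow>
          (\<forall>q p. \<phi> (q, p) = 0 \<longleftrightarrow> velocity_mismatch h A M s q p = 0)))"
proof -
  let ?s = "target \<Phi> w RR" and ?H = "hamiltonian M U"
  let ?\<mu> = "velocity_mismatch h A M ?s"
  have H: "smooth_on UNIV ?H"
    using assms(6,8,13) by (intro smooth_on_hamiltonian)
  have s: "smooth_on UNIV (\<lambda>(\<xi>, x). ?s \<xi> x)"
    using assms(17,21,22) by (intro smooth_on_target) (simp_all add: admissible_path_def)
  have \<mu>: "smooth_on UNIV (\<lambda>(q, p). ?\<mu> q p)"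
  proof -
    have fst: "smooth_on UNIV (\<lambda>x :: (real^'n) \<times> (real^'n). fst x)"
      and snd: "smooth_on UNIV (\<lambda>x :: (real^'n) \<times> (real^'n). snd x)"
      by (intro smooth_on_fst smooth_on_snd smooth_on_ident open_UNIV)+
    have Minv: "smooth_on UNIV (\<lambda>q. matrix_inv (M q))"
      using assms(6,8) by (intro smooth_on_matrix_inv pos_def_invertible)
    \<comment> \<open>The mismatch evaluates the target at \<open>\<xi> = h q\<close>, so its
      smoothness in the state comes from composing with
      \<open>x \<mapsto> (h (fst x), x)\<close>.\<close>
    have "smooth_on UNIV (\<lambda>x. (case (h (fst x), x) of (\<xi>, x) \<Rightarrow> ?s \<xi> x))"
      by (intro smooth_on_compose_UNIV[OF s] smooth_on_Pair smooth_on_compose_UNIV[OF assms(14) fst]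
          smooth_on_ident open_UNIV)
    then have "smooth_on UNIV (\<lambda>x. (jacobian h (at (fst x)) ** A (fst x) ** matrix_inv (M (fst x))) *v snd x
        - ?s (h (fst x)) x)"
      by (intro smooth_on_diff smooth_on_matrix_vector_mult smooth_on_matrix_mult snd
          smooth_on_compose_UNIV[OF smooth_on_jacobian[OF assms(14)] fst]
          smooth_on_compose_UNIV[OF assms(4) fst] smooth_on_compose_UNIV[OF Minv fst]) simp
    then show ?thesis
      by (simp add: velocity_mismatch_def case_prod_unfold)
  qed
  obtain \<phi> :: "(real^'n) \<times> (real^'n) \<Rightarrow> real^2" and u :: "(real^'n) \<times> (real^'n) \<Rightarrow> real^'m"
    where \<phi>: "smooth_on UNIV \<phi>" "smooth_on UNIV u"
      "\<And>x. frechet_derivative \<phi> (at x) (mech_field A R G ?H x (u x)) = 0"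
      "\<And>q p. \<phi> (q, p) = 0 \<Longrightarrow> ?\<mu> q p = 0"
      "(\<forall>q p. rank (jacobian (?\<mu> q) (at p) ** G q) = 2) \<longrightarrow> (\<forall>q p. \<phi> (q, p) = 0 \<longleftrightarrow> ?\<mu> q p = 0)"
  proof (cases "\<forall>q p. rank (jacobian (?\<mu> q) (at p) ** G q) = 2")
    case True
    \<comment> \<open>Under the rank condition the mismatch itself serves as \<open>\<phi>\<close>,
      and the feedback makes it a first integral.\<close>
    show thesis
    proof (rule constraint_preserving_feedback[OF assms(4,9,11) H \<mu>])
      show "rank (jacobian (\<lambda>p. case (q, p) of (q, p) \<Rightarrow> ?\<mu> q p) (at p) ** G q) = CARD(2)" for q p
        using True by simp
    next
      fix u
      assume "smooth_on UNIV u"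
        "\<And>x. frechet_derivative (\<lambda>(q, p). ?\<mu> q p) (at x) (mech_field A R G ?H x (u x)) = 0"
      then show thesis
        by (rule that[OF \<mu>]) simp_all
    qed
  next
    case False
    \<comment> \<open>Nothing ties \<open>\<phi>\<close> to the velocity mismatch here, so a constraint without zeros will do.\<close>
    show thesis
      using that[of "\<lambda>x. axis 1 1" "\<lambda>x. 0"] False by (simp add: smooth_on_const)
  qed
  have "2 \<le> CARD('n)" using assms(1,2) by simp
  show ?thesis
    unfolding Let_def
    by (rule immersion_of_constraint[OF \<open>2 \<le> CARD('n)\<close> assms(7,8) H assms(14,16,19,20) s \<phi>(1-3)], erule \<phi>(4))
      (rule exI, rule exI[of _ \<phi>], rule exI, intro conjI; (assumption | rule \<phi>))
qed

end
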